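(* There is an algorithm that, given a $\Pi_m\Sigma_s$ polynomial in $n$ variables, decides in $O(ms\sqrt{m+n})$ time whether it has a multilinear monomial in its sum-product expansion.
   Context: Polynomials are in variables $x_1,\dots,x_n$. A monomial is multilinear if every variable occurring in it has exponent $1$. A $\Pi_m\Sigma_s$ polynomial is given as a product $f_1\cdots f_m$ of $m$ clauses, each clause being a sum of at most $s$ single variables (terms of degree $1$). The monomials of its sum-product expansion are the products obtained by choosing one term from each clause; it has a multilinear monomial in its sum-product expansion if some such product is multilinear. *)

theory Defs
  imports Complex_Main "HOL-Library.Multiset"
begin

section \<open>Products of sums of variables\<close>

text \<open>
  The variable \<open>x\<^sub>i\<close> is the number \<open>i\<close>, a clause is the list of the variables it sums up, and a
  product of clauses is the list of its clauses. The input is this formal product, so a variable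
  may be repeated inside a clause, and a clause may be the empty sum.
\<close>

type_synonym clause = "nat list"

definition pi_sigma :: "nat \<Rightarrow> nat \<Rightarrow> nat \<Rightarrow> clause list \<Rightarrow> bool" where
  "pi_sigma n m s fs \<longleftrightarrow>
     length fs = m \<and> (\<forall>f \<in> set fs. length f \<le> s \<and> set f \<subseteq> {1..n})"

text \<open>A monomial is the multiset of its variables; exponents are multiplicities.\<close>

type_synonym monomial = "nat multiset"

definition multilinear :: "monomial \<Rightarrow> bool" where
  "multilinear M \<longleftrightarrow> (\<forall>x \<in># M. count M x = 1)"

definition expansion_monomials :: "clause list \<Rightarrow> monomial set" where
  "expansion_monomials fs = mset ` listset (map set fs)"

definition has_multilinear_monomial :: "clause list \<Rightarrow> bool" where
  "has_multilinear_monomial fs \<longleftrightarrow> (\<exists>M \<in> expansion_monomials fs. multilinear M)"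


section \<open>Random access machines with unit cost\<close>

text \<open>
  A program is a fixed finite list of instructions, hence it names only finitely many registers.
  The arithmetic is addition and truncated subtraction of natural numbers; there is no
  multiplication and no bit operation, and every instruction takes one step.
\<close>

datatype instr =
    Const nat nat
  | Add nat nat nat
  | Sub nat nat nat
  | Load nat nat
  | Store nat nat
  | Jump nat
  | JumpZero nat nat

type_synonym config = "nat \<times> (nat \<Rightarrow> nat) \<times> (nat \<Rightarrow> nat)"
  \<comment> \<open>program counter, registers, memory\<close>

fun exec_instr :: "instr \<Rightarrow> config \<Rightarrow> config" where
  "exec_instr (Const r k) (pc, R, M) = (pc + 1, R(r := k), M)"
| "exec_instr (Add r a b) (pc, R, M) = (pc + 1, R(r := R a + R b), M)"
| "exec_instr (Sub r a b) (pc, R, M) = (pc + 1, R(r := R a - R b), M)"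
| "exec_instr (Load r a) (pc, R, M) = (pc + 1, R(r := M (R a)), M)"
| "exec_instr (Store a b) (pc, R, M) = (pc + 1, R, M(R a := R b))"
| "exec_instr (Jump l) (pc, R, M) = (l, R, M)"
| "exec_instr (JumpZero a l) (pc, R, M) = (if R a = 0 then l else pc + 1, R, M)"

text \<open>The machine halts when the program counter leaves the program.\<close>

definition halted :: "instr list \<Rightarrow> config \<Rightarrow> bool" where
  "halted P c \<longleftrightarrow> fst c \<ge> length P"

definition step :: "instr list \<Rightarrow> config \<Rightarrow> config" where
  "step P c = (if halted P c then c else exec_instr (P ! fst c) c)"

text \<open>
  The input occupies an initial segment of the memory; all other cells and all registers are
  initially \<open>0\<close>. The answer is left in register \<open>0\<close>.
\<close>

definition initial :: "nat list \<Rightarrow> config" where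
  "initial xs = (0, \<lambda>_. 0, \<lambda>a. if a < length xs then xs ! a else 0)"

definition answer :: "config \<Rightarrow> nat" where
  "answer c = fst (snd c) 0"

definition encode :: "nat \<Rightarrow> clause list \<Rightarrow> nat list" where
  "encode n fs = n # length fs # concat (map (\<lambda>f. length f # f) fs)"

text \<open>
  As the machine stays put once it has halted, this says that \<open>P\<close>, started on the input \<open>xs\<close>,
  halts after at most \<open>t\<close> steps with answer \<open>b\<close> (\<open>1\<close> for yes, \<open>0\<close> for no).
\<close>

definition answers_within :: "instr list \<Rightarrow> nat list \<Rightarrow> nat \<Rightarrow> bool \<Rightarrow> bool" where
  "answers_within P xs t b \<longleftrightarrow>
     (let c = (step P ^^ t) (initial xs) in halted P c \<and> answer c = of_bool b)"

end

theory Submission imports Defs begin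

text \<open>
  A multilinear monomial is a choice of distinct variables, one from each clause, so the question is
  whether the bipartite graph of clauses and variables has a matching that saturates all clauses.
  Let \<open>k\<close> be the square root of \<open>m\<close>, rounded up. First an auction is held: an unmatched clause takes
  a cheapest one of its variables and raises its price by one, the previous owner becomes unmatched,
  and a clause all of whose variables cost at least \<open>k\<close> gives up. Only matched variables have positive
  prices, so there are at most \<open>m k\<close> successful bids, each taking time \<open>O(s)\<close>. Then an augmenting
  path is searched for each clause that gave up, in time \<open>O(m s)\<close>; if there is none, Hall's condition
  is violated. At most \<open>k\<close> of the searches succeed: if \<open>d\<close> of the clauses that gave up can be matched
  along with those matched in the auction, then every price level has at least \<open>d\<close> variables more than the
  next higher one, whence \<open>d k \<le> m\<close>. The total time is \<open>O(m s k)\<close>, independent of \<open>n\<close> as the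
  arrays need no initialization.
\<close>

section \<open>Structured programs\<close>

text \<open>The limit \<open>k\<close> balances two costs: about \<open>m * k\<close> bids of cost
  \<open>O(s)\<close> against about \<open>m / k\<close> successful searches of cost
  \<open>O(m s)\<close>; both become \<open>m * s * sqrt m\<close> when \<open>k\<close> is near
  \<open>sqrt m\<close>. The price argument rests on one relaxed optimality condition: the mate of a
  clause costs at most one more than any other variable of that clause. It puts the neighbours of
  the owners of one price level into the next lower level, where counting as in Hall's theorem
  applies. Prices are frozen after the auction and then serve only as a certificate, always relative
  to the matching that the auction left; the searches may reassign variables, but a matched clause
  stays matched. Two choices make uninitialized arrays usable. Zero stands for absence everywhere,
  so blank memory is a valid initial state. A clause is named by its positive, increasing memory
  address, and the stamp of a search is the address of its root, so old stamps never need
  clearing.\<close>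

type_synonym store = "nat \<Rightarrow> nat"

datatype com =
    Do instr
  | Seq com com  (infixr ";;" 60)
  | Cond nat com com
  | Loop nat com

fun straight :: "instr \<Rightarrow> bool" where
  "straight (Jump l) = False"
| "straight (JumpZero r l) = False"
| "straight i = True"

fun code_size :: "com \<Rightarrow> nat" where
  "code_size (Do i) = 1"
| "code_size (c ;; d) = code_size c + code_size d"
| "code_size (Cond r c d) = code_size c + code_size d + 2"
| "code_size (Loop r c) = code_size c + 2"

text \<open>Jump targets are absolute, so the address \<open>p\<close> at which the code will be
  placed has to be known during compilation.\<close>

fun compile :: "nat \<Rightarrow> com \<Rightarrow> instr list" where
  "compile p (Do i) = [i]"
| "compile p (c ;; d) = compile p c @ compile (p + code_size c) d"
| "compile p (Cond r c d) =
     JumpZero r (p + code_size c + 2) # compile (p + 1) c @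
     Jump (p + code_size c + code_size d + 2) # compile (p + code_size c + 2) d"
| "compile p (Loop r c) =
     JumpZero r (p + code_size c + 2) # compile (p + 1) c @ [Jump p]"

lemma length_compile [simp]: "length (compile p c) = code_size c"
  by (induction c arbitrary: p) auto

text \<open>Times are exact and count the jumps of the compiled code: the nonzero branch of a
  conditional pays for the test and for the jump over the other branch, an iteration of a loop for
  the test and for the jump back.\<close>

inductive run :: "com \<Rightarrow> store \<times> store \<Rightarrow> nat \<Rightarrow> store \<times> store \<Rightarrow> bool" where
  Do: "straight i \<Longrightarrow> run (Do i) \<sigma> 1 (snd (exec_instr i (0, \<sigma>)))"
| Seq: "run c \<sigma> t \<sigma>' \<Longrightarrow> run d \<sigma>' t' \<sigma>'' \<Longrightarrow> run (c ;; d) \<sigma> (t + t') \<sigma>''"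
| CondZero: "fst \<sigma> r = 0 \<Longrightarrow> run d \<sigma> t \<sigma>' \<Longrightarrow> run (Cond r c d) \<sigma> (1 + t) \<sigma>'"
| CondNonzero: "fst \<sigma> r \<noteq> 0 \<Longrightarrow> run c \<sigma> t \<sigma>' \<Longrightarrow> run (Cond r c d) \<sigma> (2 + t) \<sigma>'"
| LoopZero: "fst \<sigma> r = 0 \<Longrightarrow> run (Loop r c) \<sigma> 1 \<sigma>"
| LoopNonzero: "fst \<sigma> r \<noteq> 0 \<Longrightarrow> run c \<sigma> t \<sigma>' \<Longrightarrow> run (Loop r c) \<sigma>' t' \<sigma>'' \<Longrightarrow>
    run (Loop r c) \<sigma> (2 + t + t') \<sigma>''"

lemma exec_instr_straight:
  "straight i \<Longrightarrow> exec_instr i (p, \<sigma>) = (p + 1, snd (exec_instr i (0, \<sigma>)))"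
  by (cases \<sigma>; cases i) auto

lemma step_nth:
  "p = length xs \<Longrightarrow> step (xs @ i # ys) (p, \<sigma>) = exec_instr i (p, \<sigma>)"
  by (simp add: step_def halted_def)

lemma funpow_add_apply: "(f ^^ (a + b)) x = (f ^^ b) ((f ^^ a) x)"
  by (metis add.commute comp_apply funpow_add)

text \<open>The surrounding code \<open>xs\<close> and \<open>ys\<close> is arbitrary so that the
  induction hypotheses apply to parts embedded in a larger program.\<close>

lemma run_compile:
  assumes "run c \<sigma> t \<sigma>'" and "P = xs @ compile p c @ ys" and "p = length xs"
  shows "(step P ^^ t) (p, \<sigma>) = (p + code_size c, \<sigma>')"
  using assms
proof (induction arbitrary: xs ys p rule: run.induct)
  case (Do i \<sigma>)
  then show ?case using exec_instr_straight[of i p \<sigma>] by (simp add: step_nth)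
next
  case (Seq c \<sigma> t \<sigma>' d t' \<sigma>'')
  have "(step P ^^ t) (p, \<sigma>) = (p + code_size c, \<sigma>')"
    by (rule Seq.IH(1)[of xs _ "compile (p + code_size c) d @ ys"]) (use Seq.prems in auto)
  moreover have "(step P ^^ t') (p + code_size c, \<sigma>') = (p + code_size c + code_size d, \<sigma>'')"
    by (rule Seq.IH(2)[of "xs @ compile p c" _ ys]) (use Seq.prems in auto)
  ultimately show ?case by (simp add: funpow_add_apply)
next
  case (CondZero \<sigma> r d t \<sigma>' c)
  have "step P (p, \<sigma>) = (p + code_size c + 2, \<sigma>)"
    using CondZero by (cases \<sigma>) (simp add: step_nth)
  moreover have "(step P ^^ t) (p + code_size c + 2, \<sigma>) = (p + code_size c + 2 + code_size d, \<sigma>')"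
    by (rule CondZero.IH[of
          "xs @ JumpZero r (p + code_size c + 2) # compile (p + 1) c @
             [Jump (p + code_size c + code_size d + 2)]" _ ys])
      (use CondZero.prems in auto)
  ultimately show ?case by (simp only: funpow_add_apply) (simp add: ac_simps)
next
  case (CondNonzero \<sigma> r c t \<sigma>' d)
  have 1: "step P (p, \<sigma>) = (p + 1, \<sigma>)"
    using CondNonzero by (cases \<sigma>) (simp add: step_nth)
  have 2: "(step P ^^ t) (p + 1, \<sigma>) = (p + 1 + code_size c, \<sigma>')"
    by (rule CondNonzero.IH[of "xs @ [JumpZero r (p + code_size c + 2)]" _
          "Jump (p + code_size c + code_size d + 2) # compile (p + code_size c + 2) d @ ys"])
      (use CondNonzero.prems in auto)
  have 3: "step P (p + 1 + code_size c, \<sigma>') = (p + code_size c + code_size d + 2, \<sigma>')"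
    using step_nth[of "p + 1 + code_size c"
        "xs @ JumpZero r (p + code_size c + 2) # compile (p + 1) c"
        "Jump (p + code_size c + code_size d + 2)"
        "compile (p + code_size c + 2) d @ ys" \<sigma>'] CondNonzero.prems
    by (cases \<sigma>') simp
  have "(step P ^^ (2 + t)) (p, \<sigma>) = (step P ^^ 1) ((step P ^^ t) ((step P ^^ 1) (p, \<sigma>)))"
    by (simp only: funpow_add_apply[symmetric]) simp
  then show ?case using 1 2 3 by (simp add: ac_simps)
next
  case (LoopZero \<sigma> r c)
  then show ?case by (cases \<sigma>) (simp add: step_nth)
next
  case (LoopNonzero \<sigma> r c t \<sigma>' t' \<sigma>'')
  have 1: "step P (p, \<sigma>) = (p + 1, \<sigma>)"
    using LoopNonzero by (cases \<sigma>) (simp add: step_nth)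
  have 2: "(step P ^^ t) (p + 1, \<sigma>) = (p + 1 + code_size c, \<sigma>')"
    by (rule LoopNonzero.IH(1)[of "xs @ [JumpZero r (p + code_size c + 2)]" _ "Jump p # ys"])
      (use LoopNonzero.prems in auto)
  have 3: "step P (p + 1 + code_size c, \<sigma>') = (p, \<sigma>')"
    using step_nth[of "p + 1 + code_size c"
        "xs @ JumpZero r (p + code_size c + 2) # compile (p + 1) c" "Jump p" ys \<sigma>']
      LoopNonzero.prems
    by (cases \<sigma>') simp
  have 4: "(step P ^^ t') (p, \<sigma>') = (p + code_size (Loop r c), \<sigma>'')"
    by (rule LoopNonzero.IH(2)[of xs _ ys]) (use LoopNonzero.prems in auto)
  have "(step P ^^ (2 + t + t')) (p, \<sigma>) =
    (step P ^^ t') ((step P ^^ 1) ((step P ^^ t) ((step P ^^ 1) (p, \<sigma>))))"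
    by (simp only: funpow_add_apply[symmetric]) simp
  then show ?case using 1 2 3 4 by simp
qed

section \<open>Weakest preconditions with elapsed time\<close>

text \<open>
  Postconditions see the time elapsed so far. A loop invariant that bounds this time yields
  termination, because every iteration takes time.
\<close>

definition wp :: "com \<Rightarrow> (nat \<Rightarrow> store \<Rightarrow> store \<Rightarrow> bool) \<Rightarrow> nat \<Rightarrow> store \<Rightarrow> store \<Rightarrow> bool" where
  "wp c Q T R M \<longleftrightarrow> (\<exists>t R' M'. run c (R, M) t (R', M') \<and> Q (T + t) R' M')"

inductive_cases run_DoE: "run (Do i) \<sigma> t \<sigma>'"
inductive_cases run_SeqE: "run (c ;; d) \<sigma> t \<sigma>'"
inductive_cases run_CondE: "run (Cond r c d) \<sigma> t \<sigma>'"

lemma wp_Do: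
  assumes "straight i"
  shows "wp (Do i) Q T R M =
    Q (T + 1) (fst (snd (exec_instr i (0, R, M)))) (snd (snd (exec_instr i (0, R, M))))"
proof
  show "wp (Do i) Q T R M \<Longrightarrow>
      Q (T + 1) (fst (snd (exec_instr i (0, R, M)))) (snd (snd (exec_instr i (0, R, M))))"
    unfolding wp_def by (elim exE conjE run_DoE) (simp, metis fst_conv snd_conv)
  show "Q (T + 1) (fst (snd (exec_instr i (0, R, M)))) (snd (snd (exec_instr i (0, R, M)))) \<Longrightarrow>
      wp (Do i) Q T R M"
    unfolding wp_def using run.Do[OF assms, of "(R, M)"] by (metis prod.collapse)
qed

lemma wp_instr [simp]:
  "wp (Do (Const r k)) Q T R M = Q (T + 1) (R(r := k)) M"
  "wp (Do (Add r a b)) Q T R M = Q (T + 1) (R(r := R a + R b)) M"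
  "wp (Do (Sub r a b)) Q T R M = Q (T + 1) (R(r := R a - R b)) M"
  "wp (Do (Load r a)) Q T R M = Q (T + 1) (R(r := M (R a))) M"
  "wp (Do (Store a b)) Q T R M = Q (T + 1) R (M(R a := R b))"
  by (simp_all add: wp_Do)

lemma wp_Seq [simp]: "wp (c ;; d) Q T R M = wp c (wp d Q) T R M"
proof
  show "wp (c ;; d) Q T R M \<Longrightarrow> wp c (wp d Q) T R M"
    unfolding wp_def by (elim exE conjE run_SeqE) (metis add.assoc prod.collapse)
  show "wp c (wp d Q) T R M \<Longrightarrow> wp (c ;; d) Q T R M"
    unfolding wp_def by (metis run.Seq add.assoc)
qed

lemma wp_Cond [simp]:
  "wp (Cond r c d) Q T R M = (if R r = 0 then wp d Q (T + 1) R M else wp c Q (T + 2) R M)"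
proof
  show "wp (Cond r c d) Q T R M \<Longrightarrow> (if R r = 0 then wp d Q (T + 1) R M else wp c Q (T + 2) R M)"
    unfolding wp_def by (elim exE conjE run_CondE) (auto simp: add.assoc)
  show "(if R r = 0 then wp d Q (T + 1) R M else wp c Q (T + 2) R M) \<Longrightarrow> wp (Cond r c d) Q T R M"
    unfolding wp_def
    by (cases "R r = 0")
      (metis run.CondZero add.assoc fst_conv, metis run.CondNonzero add.assoc fst_conv)
qed

lemma wp_Loop:
  assumes "I T R M"
    and bound: "\<And>T R M. I T R M \<Longrightarrow> T \<le> B"
    and body: "\<And>T R M. I T R M \<Longrightarrow> R r \<noteq> 0 \<Longrightarrow> wp c I (T + 2) R M"
    and exit: "\<And>T R M. I T R M \<Longrightarrow> R r = 0 \<Longrightarrow> Q (T + 1) R M"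
  shows "wp (Loop r c) Q T R M"
  using assms(1)
proof (induction "B + 1 - T" arbitrary: T R M rule: less_induct)
  case less
  show ?case
  proof (cases "R r = 0")
    case True
    then show ?thesis
      using exit[OF less.prems] run.LoopZero[of "(R, M)" r c] unfolding wp_def by fastforce
  next
    case False
    obtain t R' M' where run: "run c (R, M) t (R', M')" and inv: "I (T + 2 + t) R' M'"
      using body[OF less.prems False] by (auto simp: wp_def)
    have "wp (Loop r c) Q (T + 2 + t) R' M'"
      using less.hyps[OF _ inv] bound[OF less.prems] by simp
    then obtain t' R'' M'' where
      "run (Loop r c) (R', M') t' (R'', M'')" "Q (T + (2 + t + t')) R'' M''"
      by (auto simp: wp_def add.assoc)
    then show ?thesis
      using run.LoopNonzero[of "(R, M)" r c t "(R', M')" t' "(R'', M'')"] run False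
      unfolding wp_def by (intro exI[of _ "2 + t + t'"] exI[of _ R''] exI[of _ M'']) simp
  qed
qed


section \<open>Matching clauses with variables\<close>

text \<open>
  An unmatched clause has mate \<open>0\<close> and an unowned variable has owner \<open>0\<close>; correspondingly \<open>0\<close> is
  neither a clause nor a variable.
\<close>

locale clause_graph =
  fixes A :: "nat set" and Nb :: "nat \<Rightarrow> nat set"
  assumes finite_A: "finite A"
    and zero_notin_A: "0 \<notin> A"
    and finite_Nb: "u \<in> A \<Longrightarrow> finite (Nb u)"
    and zero_notin_Nb: "u \<in> A \<Longrightarrow> 0 \<notin> Nb u"
begin

definition saturates :: "(nat \<Rightarrow> nat) \<Rightarrow> nat set \<Rightarrow> bool" where
  "saturates g U \<longleftrightarrow> inj_on g U \<and> (\<forall>u \<in> U. g u \<in> Nb u)"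

lemma saturates_subset: "saturates g U \<Longrightarrow> V \<subseteq> U \<Longrightarrow> saturates g V"
  unfolding saturates_def using inj_on_subset by blast

text \<open>The easy direction of Hall's theorem. It drives both the count of successful searches
  and the refutation after a failed one.\<close>

lemma saturates_card_le:
  assumes "saturates g U" and "\<And>u. u \<in> U \<Longrightarrow> Nb u \<subseteq> Y" and "finite Y"
  shows "card U \<le> card Y"
  by (rule card_inj_on_le[of g]) (use assms in \<open>auto simp: saturates_def\<close>)

definition matching :: "(nat \<Rightarrow> nat) \<Rightarrow> (nat \<Rightarrow> nat) \<Rightarrow> bool" where
  "matching ow mt \<longleftrightarrow>
     (\<forall>x. ow x \<noteq> 0 \<longrightarrow> x \<noteq> 0 \<and> mt (ow x) = x) \<and>
     (\<forall>u. mt u \<noteq> 0 \<longrightarrow> u \<in> A \<and> mt u \<in> Nb u \<and> ow (mt u) = u)"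

lemma matching_mateD:
  assumes "matching ow mt" and "mt u \<noteq> 0"
  shows "u \<in> A" and "mt u \<in> Nb u" and "ow (mt u) = u"
  using assms unfolding matching_def by blast+

lemma matching_ownerD:
  assumes "matching ow mt" and "ow x \<noteq> 0"
  shows "x \<noteq> 0" and "mt (ow x) = x" and "ow x \<in> A"
proof -
  show "x \<noteq> 0" "mt (ow x) = x" using assms unfolding matching_def by blast+
  then show "ow x \<in> A" using matching_mateD(1)[OF assms(1), of "ow x"] by metis
qed

lemma matching_saturates:
  assumes "matching ow mt"
  shows "saturates mt {u. mt u \<noteq> 0}"
proof -
  have "inj_on mt {u. mt u \<noteq> 0}"
    by (rule inj_on_inverseI[of _ ow]) (use matching_mateD[OF assms] in blast)
  then show ?thesis using matching_mateD[OF assms] unfolding saturates_def by blast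
qed

lemma matching_owned:
  assumes "matching ow mt"
  shows "finite {x. ow x \<noteq> 0}" and "card {x. ow x \<noteq> 0} \<le> card A"
proof -
  have "inj_on ow {x. ow x \<noteq> 0}"
    by (rule inj_on_inverseI[of _ mt]) (use matching_ownerD[OF assms] in blast)
  moreover have "ow ` {x. ow x \<noteq> 0} \<subseteq> A"
    using matching_ownerD[OF assms] by blast
  ultimately show "finite {x. ow x \<noteq> 0}" "card {x. ow x \<noteq> 0} \<le> card A"
    using inj_on_finite[OF _ _ finite_A] card_inj_on_le[OF _ _ finite_A] by simp_all
qed


subsection \<open>The auction\<close>

text \<open>The last conjunct is the approximate complementary slackness of auction algorithms, with
  price increment one.\<close>

definition priced :: "nat \<Rightarrow> (nat \<Rightarrow> nat) \<Rightarrow> (nat \<Rightarrow> nat) \<Rightarrow> (nat \<Rightarrow> nat) \<Rightarrow> bool" where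
  "priced k ow mt pr \<longleftrightarrow>
     matching ow mt \<and> (\<forall>x. pr x \<le> k) \<and> (\<forall>x. pr x \<noteq> 0 \<longrightarrow> ow x \<noteq> 0) \<and>
     (\<forall>u. \<forall>y \<in> Nb u. mt u \<noteq> 0 \<longrightarrow> pr (mt u) \<le> pr y + 1)"

text \<open>Since \<open>x\<close> was cheapest for \<open>u\<close>, its raised price exceeds no
  neighbour's price by more than one. Every other clause that remains matched keeps a mate other
  than \<open>x\<close>, whose price is unchanged, while the prices of its neighbours can only
  rise.\<close>

lemma priced_bid:
  assumes priced: "priced k ow mt pr" and u: "u \<in> A" "mt u = 0"
    and x: "x \<in> Nb u" "pr x < k" "\<And>y. y \<in> Nb u \<Longrightarrow> pr x \<le> pr y"
  shows "priced k (ow(x := u)) ((mt(u := x))(ow x := 0)) (pr(x := pr x + 1))"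
proof -
  have match: "matching ow mt" using priced by (simp add: priced_def)
  note ow = matching_ownerD[OF match] and mt = matching_mateD[OF match]
  have u0: "u \<noteq> 0" using u(1) zero_notin_A by metis
  have x0: "x \<noteq> 0" using u(1) x(1) zero_notin_Nb by metis
  \<comment> \<open>If \<open>x\<close> has an owner, that clause is matched while \<open>u\<close>
    is not; if it has none, \<open>ow x\<close> is \<open>0\<close> while \<open>u\<close> is not.
    Hence the two updates of \<open>mt\<close> never collide.\<close>
  have ne: "ow x \<noteq> u" using ow[of x] u(2) u0 x0 by auto
  let ?mt = "(mt(u := x))(ow x := 0)"
  have "matching (ow(x := u)) ?mt"
    unfolding matching_def
  proof (intro conjI allI impI)
    fix z assume z: "(ow(x := u)) z \<noteq> 0"
    show "z \<noteq> 0"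
    proof (cases "z = x")
      case False
      then show ?thesis using z ow[of z] by simp
    qed (simp add: x0)
    show "?mt ((ow(x := u)) z) = z"
    proof (cases "z = x")
      case True
      then show ?thesis using ne by simp
    next
      case False
      then have "mt (ow z) = z" "z \<noteq> 0" using z ow[of z] by simp_all
      moreover have "ow z \<noteq> u" using calculation u(2) by metis
      moreover have "ow z \<noteq> ow x"
      proof
        assume eq: "ow z = ow x"
        then have "ow x \<noteq> 0" using z False by simp
        then show False using ow[of x] calculation eq False by metis
      qed
      ultimately show ?thesis using False by simp
    qed
  next
    fix v assume "?mt v \<noteq> 0"
    then have v: "v \<noteq> ow x" "v \<noteq> u \<Longrightarrow> mt v \<noteq> 0" by (auto split: if_splits)
    show "v \<in> A" "?mt v \<in> Nb v" "(ow(x := u)) (?mt v) = v"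
      using v u(1) x(1) mt[of v] by (cases "v = u"; auto)+
  qed
  moreover have "(pr(x := pr x + 1)) (?mt v) \<le> (pr(x := pr x + 1)) y + 1"
    if y: "y \<in> Nb v" and "?mt v \<noteq> 0" for v y
  proof (cases "v = u")
    case True
    then show ?thesis using ne x(3)[of y] y by simp
  next
    case False
    then have v: "v \<noteq> ow x" "mt v \<noteq> 0" using \<open>?mt v \<noteq> 0\<close> by (auto split: if_splits)
    then have "pr (mt v) \<le> pr y + 1" using priced y unfolding priced_def by blast
    then show ?thesis using False v mt[of v] by auto
  qed
  ultimately show ?thesis
    using priced x(2) u0 unfolding priced_def by simp
qed

text \<open>
  The clauses in \<open>S\<close> have entered the auction, and \<open>u\<close> is the one bidding now (\<open>0\<close> for none).
\<close>

definition bidding ::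
    "nat \<Rightarrow> nat set \<Rightarrow> nat \<Rightarrow> (nat \<Rightarrow> nat) \<Rightarrow> (nat \<Rightarrow> nat) \<Rightarrow> (nat \<Rightarrow> nat) \<Rightarrow> bool" where
  "bidding k S u ow mt pr \<longleftrightarrow>
     priced k ow mt pr \<and> S \<subseteq> A \<and> (u \<noteq> 0 \<longrightarrow> u \<in> S \<and> mt u = 0) \<and>
     (\<forall>v \<in> S. v \<noteq> u \<longrightarrow> mt v = 0 \<longrightarrow> (\<forall>y \<in> Nb v. k \<le> pr y)) \<and>
     (\<forall>v. mt v \<noteq> 0 \<longrightarrow> v \<in> S)"

lemma bidding_init: "bidding k {} 0 (\<lambda>_. 0) (\<lambda>_. 0) (\<lambda>_. 0)"
  by (simp add: bidding_def priced_def matching_def)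

lemma bidding_enter:
  assumes bid: "bidding k S 0 ow mt pr" and u: "u \<in> A" "u \<notin> S"
  shows "bidding k (insert u S) u ow mt pr"
proof -
  have "S \<subseteq> A" and mate: "\<And>v. mt v \<noteq> 0 \<Longrightarrow> v \<in> S"
    using bid unfolding bidding_def by blast+
  have "k \<le> pr y" if "v \<in> S" "mt v = 0" "y \<in> Nb v" for v y
  proof -
    have "v \<noteq> 0" using that(1) \<open>S \<subseteq> A\<close> zero_notin_A by (metis subsetD)
    then show ?thesis using bid that unfolding bidding_def by blast
  qed
  moreover have "mt u = 0" using mate u(2) by blast
  ultimately show ?thesis using bid u(1) mate unfolding bidding_def by simp
qed

lemma bidding_giveup:
  assumes bid: "bidding k S u ow mt pr" and out: "\<And>y. y \<in> Nb u \<Longrightarrow> k \<le> pr y"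
  shows "bidding k S 0 ow mt pr"
proof -
  have "k \<le> pr y" if "v \<in> S" "mt v = 0" "y \<in> Nb v" for v y
  proof (cases "v = u")
    case False
    then show ?thesis using bid that unfolding bidding_def by blast
  qed (use out that in blast)
  then show ?thesis using bid unfolding bidding_def by simp
qed

text \<open>The evicted owner becomes the next bidder, and \<open>0\<close> in its place ends the
  bidding. Clauses that gave up stay out of the market because prices never fall.\<close>

lemma bidding_bid:
  assumes bid: "bidding k S u ow mt pr" and "u \<noteq> 0"
    and x: "x \<in> Nb u" "pr x < k" "\<And>y. y \<in> Nb u \<Longrightarrow> pr x \<le> pr y"
  shows "bidding k S (ow x) (ow(x := u)) ((mt(u := x))(ow x := 0)) (pr(x := pr x + 1))"
proof -
  have u: "u \<in> S" "u \<in> A" "mt u = 0" and priced: "priced k ow mt pr"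
    using bid \<open>u \<noteq> 0\<close> unfolding bidding_def by blast+
  have match: "matching ow mt" using priced by (simp add: priced_def)
  have old: "ow x \<in> S" if "ow x \<noteq> 0"
  proof -
    have "mt (ow x) \<noteq> 0" using matching_ownerD(1,2)[OF match that] by metis
    then show ?thesis using bid unfolding bidding_def by blast
  qed
  have "priced k (ow(x := u)) ((mt(u := x))(ow x := 0)) (pr(x := pr x + 1))"
    by (rule priced_bid[OF priced u(2,3) x])
  moreover have "k \<le> (pr(x := pr x + 1)) y"
    if "v \<in> S" "v \<noteq> ow x" "((mt(u := x))(ow x := 0)) v = 0" "y \<in> Nb v" for v y
  proof -
    have "v \<noteq> u" using that zero_notin_Nb[OF u(2)] x(1) by (auto split: if_splits)
    then have "k \<le> pr y" using that bid unfolding bidding_def by auto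
    then show ?thesis by auto
  qed
  moreover have "v \<in> S" if "((mt(u := x))(ow x := 0)) v \<noteq> 0" for v
  proof (cases "v = u")
    case False
    then have "mt v \<noteq> 0" using that by (auto split: if_splits)
    then show ?thesis using bid unfolding bidding_def by blast
  qed (use u in simp)
  ultimately show ?thesis
    using old bid unfolding bidding_def by simp
qed

lemma priced_sum_le:
  assumes "priced k ow mt pr" and "finite X"
  shows "sum pr X \<le> k * card A"
proof -
  have match: "matching ow mt" using assms by (simp add: priced_def)
  have "sum pr X = sum pr {x \<in> X. pr x \<noteq> 0}"
    by (rule sum.mono_neutral_right) (use assms in auto)
  also have "\<dots> \<le> sum pr {x. ow x \<noteq> 0}"
    by (rule sum_mono2[OF matching_owned(1)[OF match]]) (use assms in \<open>auto simp: priced_def\<close>)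
  also have "\<dots> \<le> card {x. ow x \<noteq> 0} * k"
    using sum_bounded_above[of "{x. ow x \<noteq> 0}" pr k] assms by (simp add: priced_def)
  also have "\<dots> \<le> card A * k"
    using matching_owned(2)[OF match] by simp
  finally show ?thesis by (simp add: mult.commute)
qed

text \<open>
  The neighbours of \<open>F\<close> and of the owners of the variables priced at least \<open>j\<close> cost at least \<open>j - 1\<close>,
  so lowering the price threshold by one adds at least \<open>card F\<close> variables.
\<close>

lemma priced_deficiency:
  assumes priced: "priced k ow mt pr"
    and F: "F \<subseteq> A" "\<And>u. u \<in> F \<Longrightarrow> mt u = 0" "\<And>u y. u \<in> F \<Longrightarrow> y \<in> Nb u \<Longrightarrow> k \<le> pr y"
    and sat: "saturates g ({u. mt u \<noteq> 0} \<union> F)"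
  shows "card F * k \<le> card A"
proof -
  have match: "matching ow mt" using priced by (simp add: priced_def)
  define L where "L j = {x. j \<le> pr x}" for j
  \<comment> \<open>Level \<open>0\<close> contains all natural numbers, so finiteness holds only
    from level \<open>1\<close> on.\<close>
  have owned: "L j \<subseteq> {x. ow x \<noteq> 0}" if "j \<ge> 1" for j
    using priced that by (auto simp: L_def priced_def)
  have fin: "finite (L j)" if "j \<ge> 1" for j
    by (rule finite_subset[OF owned[OF that] matching_owned(1)[OF match]])
  have step: "card (L (j + 1)) + card F \<le> card (L j)" if j: "1 \<le> j" "j \<le> k" for j
  proof -
    have mate: "mt (ow x) = x" "mt (ow x) \<noteq> 0" if "x \<in> L (j + 1)" for x
    proof -
      have "ow x \<noteq> 0" using that owned[of "j + 1"] by auto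
      then show "mt (ow x) = x" "mt (ow x) \<noteq> 0" using matching_ownerD[OF match] by metis+
    qed
    have inj: "inj_on ow (L (j + 1))"
      by (rule inj_on_inverseI[of _ mt]) (rule mate(1))
    have "Nb v \<subseteq> L j" if v: "v \<in> ow ` L (j + 1) \<union> F" for v
    proof (cases "v \<in> F")
      case True
      then show ?thesis using F(3)[of v] j by (auto simp: L_def intro: order_trans)
    next
      case False
      then obtain x where x: "x \<in> L (j + 1)" "v = ow x" using v by blast
      show ?thesis
      proof
        fix y assume "y \<in> Nb v"
        then have "pr x \<le> pr y + 1"
          using priced mate[OF x(1)] x(2) unfolding priced_def by metis
        then show "y \<in> L j" using x(1) by (simp add: L_def)
      qed
    qed
    moreover have "saturates g (ow ` L (j + 1) \<union> F)"
      by (rule saturates_subset[OF sat]) (use mate in auto)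
    ultimately have "card (ow ` L (j + 1) \<union> F) \<le> card (L j)"
      using fin[of j] j by (intro saturates_card_le) auto
    moreover have "card (ow ` L (j + 1) \<union> F) = card (L (j + 1)) + card F"
    proof (subst card_Un_disjoint)
      show "finite (ow ` L (j + 1))" using fin by simp
      show "finite F" using F(1) finite_A finite_subset by blast
      show "ow ` L (j + 1) \<inter> F = {}" using mate F(2) by fastforce
    qed (use card_image[OF inj] in simp)
    ultimately show ?thesis by simp
  qed
  \<comment> \<open>The steps are summed downward from level \<open>k + 1\<close>; after
    \<open>k\<close> of them level \<open>1\<close> is reached, whose variables are all
    owned.\<close>
  have "card F * i \<le> card (L (k + 1 - i))" if "i \<le> k" for i
    using that
  proof (induction i)
    case (Suc i)
    then have "card F * i \<le> card (L (k - i + 1))" by (simp add: Suc_diff_le)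
    moreover have "1 \<le> k - i" using Suc.prems by simp
    ultimately show ?case using step[of "k - i"] by simp
  qed simp
  then have "card F * k \<le> card (L 1)" by (metis add_diff_cancel_left' order_refl)
  also have "\<dots> \<le> card {x. ow x \<noteq> 0}"
    by (rule card_mono[OF matching_owned(1)[OF match] owned]) simp
  also have "\<dots> \<le> card A" by (rule matching_owned(2)[OF match])
  finally show ?thesis .
qed


subsection \<open>Searching for an augmenting path\<close>

text \<open>
  Clauses are reached in the order of the queue \<open>q\<close>; the variables reached carry the stamp \<open>c\<close>, and
  \<open>f\<close> is a reached unowned variable, or \<open>0\<close> if there is none so far.
\<close>

definition tree :: "nat \<Rightarrow> (nat \<Rightarrow> nat) \<Rightarrow> (nat \<Rightarrow> nat) \<Rightarrow> nat list \<Rightarrow> bool" where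
  "tree c mt pa q \<longleftrightarrow>
     q \<noteq> [] \<and> q ! 0 = c \<and> distinct q \<and> set q \<subseteq> A \<and> mt c = 0 \<and>
     (\<forall>i. 0 < i \<longrightarrow> i < length q \<longrightarrow>
        mt (q ! i) \<noteq> 0 \<and> (\<exists>j<i. pa (mt (q ! i)) = q ! j \<and> mt (q ! i) \<in> Nb (q ! j)))"

text \<open>\<open>tree\<close> is separate because walking back along the path uses only parents
  and queue order, whereas stamps serve the closure argument. Finding an unowned variable does not
  stop the exploration; a later find replaces \<open>f\<close>.\<close>

definition search ::
    "nat \<Rightarrow> (nat \<Rightarrow> nat) \<Rightarrow> (nat \<Rightarrow> nat) \<Rightarrow> (nat \<Rightarrow> nat) \<Rightarrow> (nat \<Rightarrow> nat) \<Rightarrow> nat list \<Rightarrow> nat \<Rightarrow> bool" where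
  "search c ow mt st pa q f \<longleftrightarrow>
     matching ow mt \<and> tree c mt pa q \<and>
     (\<forall>i. 0 < i \<longrightarrow> i < length q \<longrightarrow> st (mt (q ! i)) = c) \<and>
     (\<forall>x. st x = c \<longrightarrow> (if ow x = 0 then f \<noteq> 0 else ow x \<in> set q)) \<and>
     (f \<noteq> 0 \<longrightarrow> ow f = 0 \<and> st f = c \<and> (\<exists>j<length q. pa f = q ! j \<and> f \<in> Nb (q ! j)))"

lemma search_init:
  assumes "matching ow mt" and "c \<in> A" and "mt c = 0" and "\<And>x. st x \<noteq> c"
  shows "search c ow mt st pa [c] 0"
  using assms by (auto simp: search_def tree_def)

lemma searchD:
  assumes "search c ow mt st pa q f"
  shows "matching ow mt" and "tree c mt pa q"
    and "0 < i \<Longrightarrow> i < length q \<Longrightarrow> st (mt (q ! i)) = c"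
    and "st x = c \<Longrightarrow> ow x = 0 \<Longrightarrow> f \<noteq> 0"
    and "st x = c \<Longrightarrow> ow x \<noteq> 0 \<Longrightarrow> ow x \<in> set q"
    and "f \<noteq> 0 \<Longrightarrow> ow f = 0 \<and> st f = c"
    and "f \<noteq> 0 \<Longrightarrow> \<exists>j<length q. pa f = q ! j \<and> f \<in> Nb (q ! j)"
  using assms unfolding search_def by (auto simp del: neq0_conv)

text \<open>An unstamped variable is the mate of no queued clause, so overwriting its parent leaves
  the tree intact.\<close>

lemma search_unowned:
  assumes S: "search c ow mt st pa q f"
    and u: "u \<in> set q" "x \<in> Nb u" "st x \<noteq> c" and "ow x = 0"
  shows "search c ow mt (st(x := c)) (pa(x := u)) q x"
proof -
  have tree: "tree c mt pa q" by (rule searchD(2)[OF S])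
  have "u \<in> A" using tree u(1) by (auto simp: tree_def)
  then have "x \<noteq> 0" using u(2) zero_notin_Nb by metis
  have ne: "mt (q ! i) \<noteq> x" if "0 < i" "i < length q" for i
    using searchD(3)[OF S that] u(3) by auto
  obtain j where j: "j < length q" "u = q ! j"
    using u(1) by (metis in_set_conv_nth)
  have "tree c mt (pa(x := u)) q"
    using tree ne unfolding tree_def by simp
  moreover have "(st(x := c)) (mt (q ! i)) = c" if "0 < i" "i < length q" for i
    using searchD(3)[OF S that] by simp
  moreover have "if ow z = 0 then x \<noteq> 0 else ow z \<in> set q" if "(st(x := c)) z = c" for z
    using that searchD(5)[OF S, of z] \<open>x \<noteq> 0\<close> assms(5) by (auto split: if_splits)
  moreover have "\<exists>j<length q. (pa(x := u)) x = q ! j \<and> x \<in> Nb (q ! j)"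
    using j u(2) by auto
  ultimately show ?thesis
    using searchD(1)[OF S] assms(5) unfolding search_def by simp
qed

text \<open>The queue stays free of duplicates: had the owner of \<open>x\<close> been queued, its
  mate \<open>x\<close> would already be stamped, unless it were the root, which has no
  mate.\<close>

lemma search_owned:
  assumes S: "search c ow mt st pa q f"
    and u: "u \<in> set q" "x \<in> Nb u" "st x \<noteq> c" and "ow x \<noteq> 0"
  shows "search c ow mt (st(x := c)) (pa(x := u)) (q @ [ow x]) f"
proof -
  have match: "matching ow mt" and tree: "tree c mt pa q" using S by (auto simp: search_def)
  note x = matching_ownerD[OF match \<open>ow x \<noteq> 0\<close>]
  have ne: "mt (q ! i) \<noteq> x" if "0 < i" "i < length q" for i
    using S u(3) that unfolding search_def by blast
  have new: "ow x \<notin> set q"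
  proof
    assume "ow x \<in> set q"
    then obtain i where i: "i < length q" "ow x = q ! i" by (metis in_set_conv_nth)
    moreover have "mt (q ! 0) = 0" using tree by (simp add: tree_def)
    ultimately have "i \<noteq> 0" using x by metis
    then show False using ne[of i] i x by auto
  qed
  obtain l where l: "l < length q" "u = q ! l" using u(1) by (metis in_set_conv_nth)
  have 1: "tree c mt (pa(x := u)) (q @ [ow x])"
    unfolding tree_def
  proof (intro conjI allI impI)
    show "q @ [ow x] \<noteq> []" "(q @ [ow x]) ! 0 = c" "distinct (q @ [ow x])"
      "set (q @ [ow x]) \<subseteq> A" "mt c = 0"
      using tree new x by (auto simp: tree_def nth_append)
  next
    fix i assume i: "0 < i" "i < length (q @ [ow x])"
    show "mt ((q @ [ow x]) ! i) \<noteq> 0"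
      using i tree x by (auto simp: tree_def nth_append)
    show "\<exists>j<i. (pa(x := u)) (mt ((q @ [ow x]) ! i)) = (q @ [ow x]) ! j \<and>
        mt ((q @ [ow x]) ! i) \<in> Nb ((q @ [ow x]) ! j)"
    proof (cases "i < length q")
      case True
      then obtain j where "j < i" "pa (mt (q ! i)) = q ! j" "mt (q ! i) \<in> Nb (q ! j)"
        using tree i unfolding tree_def by blast
      then show ?thesis using True ne[OF i(1) True] by (intro exI[of _ j]) (simp add: nth_append)
    next
      case False
      then have "i = length q" using i by simp
      then show ?thesis using l u(2) x by (intro exI[of _ l]) (simp add: nth_append)
    qed
  qed
  have 2: "(st(x := c)) (mt ((q @ [ow x]) ! i)) = c" if "0 < i" "i < length (q @ [ow x])" for i
    using that searchD(3)[OF S, of i] x by (auto simp: nth_append less_Suc_eq)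
  have 3: "(if ow z = 0 then f \<noteq> 0 else ow z \<in> set (q @ [ow x]))"
    if "(st(x := c)) z = c" for z
    using that searchD(4,5)[OF S, of z] assms(5) by (auto split: if_splits)
  have 4: "ow f = 0 \<and> (st(x := c)) f = c \<and>
      (\<exists>j<length (q @ [ow x]). (pa(x := u)) f = (q @ [ow x]) ! j \<and> f \<in> Nb ((q @ [ow x]) ! j))"
    if f: "f \<noteq> 0"
  proof -
    obtain j where "j < length q" "pa f = q ! j" "f \<in> Nb (q ! j)"
      using searchD(7)[OF S f] by blast
    moreover have "ow f = 0" "st f = c" "f \<noteq> x"
      using searchD(6)[OF S f] u(3) by auto
    ultimately show ?thesis by (intro conjI exI[of _ j]) (auto simp: nth_append)
  qed
  show ?thesis
    unfolding search_def by (intro conjI allI impI match 1 2 3) (use 4 in blast)+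
qed

text \<open>An unsuccessful search violates Hall's condition.\<close>

lemma search_fails:
  assumes S: "search c ow mt st pa q 0"
    and closed: "\<And>u x. u \<in> set q \<Longrightarrow> x \<in> Nb u \<Longrightarrow> st x = c"
  shows "\<not> saturates g A"
proof
  assume "saturates g A"
  moreover have q: "set q \<subseteq> A" "c \<in> set q" "mt c = 0" and match: "matching ow mt"
    using S by (auto simp: search_def tree_def)
  ultimately have sat: "saturates g (set q)" using saturates_subset by blast
  \<comment> \<open>As \<open>f\<close> is \<open>0\<close>, every stamped variable is owned by a
    queued clause. The unmatched root owns nothing, so the neighbourhood of the queue is smaller
    than the queue by at least one.\<close>
  have "Nb u \<subseteq> mt ` (set q - {c})" if "u \<in> set q" for u
  proof
    fix x assume "x \<in> Nb u"
    then have "st x = c" using closed that by blast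
    then have "ow x \<noteq> 0 \<and> ow x \<in> set q" using S unfolding search_def by (metis less_irrefl)
    then show "x \<in> mt ` (set q - {c})"
      using matching_ownerD[OF match, of x] q(3) by (intro image_eqI[of _ _ "ow x"]) auto
  qed
  then have "card (set q) \<le> card (mt ` (set q - {c}))"
    using saturates_card_le[OF sat] by simp
  also have "\<dots> \<le> card (set q - {c})" by (simp add: card_image_le)
  also have "\<dots> < card (set q)" using q(2) by (meson List.finite_set card_Diff1_less)
  finally show False by simp
qed

section \<open>Augmentation along parent pointers\<close>

text \<open>
  \<open>x\<close> is still to be handed to its parent clause, the one at position \<open>i\<close> in the queue, while \<open>mt0\<close>
  is the matching that is being augmented; \<open>x = 0\<close> means that the augmentation is complete.
\<close>

definition augmenting ::
    "nat \<Rightarrow> (nat \<Rightarrow> nat) \<Rightarrow> (nat \<Rightarrow> nat) \<Rightarrow> nat list \<Rightarrow> nat \<Rightarrow> nat \<Rightarrow> (nat \<Rightarrow> nat) \<Rightarrow> (nat \<Rightarrow> nat) \<Rightarrow> bool" where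
  "augmenting c mt0 pa q x i ow mt \<longleftrightarrow>
     ow 0 = 0 \<and> (\<forall>z. z \<noteq> x \<longrightarrow> ow z \<noteq> 0 \<longrightarrow> mt (ow z) = z) \<and>
     (\<forall>u. mt u \<noteq> 0 \<longrightarrow> u \<in> A \<and> mt u \<in> Nb u \<and> ow (mt u) = u \<and> mt u \<noteq> x) \<and>
     (x \<noteq> 0 \<longrightarrow> i < length q \<and> pa x = q ! i \<and> x \<in> Nb (q ! i) \<and> (\<forall>j\<le>i. mt (q ! j) = mt0 (q ! j))) \<and>
     {u. mt u \<noteq> 0} = {u. mt0 u \<noteq> 0} \<union> (if x = 0 then {c} else {})"

lemma augmenting_init:
  assumes S: "search c ow mt st pa q f" and "f \<noteq> 0"
  obtains i where "i < length q" and "augmenting c mt pa q f i ow mt"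
proof -
  obtain i where i: "i < length q" "pa f = q ! i" "f \<in> Nb (q ! i)"
    using searchD(7)[OF S \<open>f \<noteq> 0\<close>] by blast
  note ow = matching_ownerD[OF searchD(1)[OF S]] and mt = matching_mateD[OF searchD(1)[OF S]]
  have "mt u \<noteq> f" if "mt u \<noteq> 0" for u
    using mt[OF that] searchD(6)[OF S \<open>f \<noteq> 0\<close>] zero_notin_A by metis
  then have "augmenting c mt pa q f i ow mt"
    using ow[of 0] ow(2) mt i \<open>f \<noteq> 0\<close> unfolding augmenting_def
    by (intro conjI allI impI) (blast | simp)+
  then show thesis using that i by blast
qed

lemma augmenting_final:
  assumes "augmenting c mt0 pa q 0 i ow mt"
  shows "matching ow mt" and "{u. mt u \<noteq> 0} = insert c {u. mt0 u \<noteq> 0}"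
proof -
  have aug: "ow 0 = 0" "\<And>z. z \<noteq> 0 \<Longrightarrow> ow z \<noteq> 0 \<Longrightarrow> mt (ow z) = z"
    "\<And>u. mt u \<noteq> 0 \<Longrightarrow> u \<in> A \<and> mt u \<in> Nb u \<and> ow (mt u) = u"
    "{u. mt u \<noteq> 0} = {u. mt0 u \<noteq> 0} \<union> {c}"
    using assms unfolding augmenting_def by simp_all
  show "matching ow mt" unfolding matching_def using aug(1-3) by metis
  show "{u. mt u \<noteq> 0} = insert c {u. mt0 u \<noteq> 0}" using aug(4) by simp
qed

text \<open>The old mate of \<open>u\<close> becomes the pending variable, and its parent stands
  earlier in the queue. Only mates at later positions have been changed, so the tree recorded for
  \<open>mt0\<close> still describes the rest of the path. The decreasing position \<open>i\<close>
  also bounds the number of steps.\<close>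

lemma augmenting_step:
  assumes aug: "augmenting c mt0 pa q x i ow mt" and tree: "tree c mt0 pa q" and x: "x \<noteq> 0"
    and u: "u = pa x"
  obtains "mt u = 0" and "augmenting c mt0 pa q 0 0 (ow(x := u)) (mt(u := x))"
  | j where "mt u \<noteq> 0" and "j < i" and "augmenting c mt0 pa q (mt u) j (ow(x := u)) (mt(u := x))"
proof -
  have i: "i < length q" "u = q ! i" "x \<in> Nb u" and mt0: "mt u = mt0 u"
    and same: "\<And>j. j \<le> i \<Longrightarrow> mt (q ! j) = mt0 (q ! j)"
    using aug x u unfolding augmenting_def by auto
  have uA: "u \<in> A" using tree i unfolding tree_def by auto
  have ow_mt: "\<And>z. z \<noteq> x \<Longrightarrow> ow z \<noteq> 0 \<Longrightarrow> mt (ow z) = z"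
    and mt_ow: "\<And>v. mt v \<noteq> 0 \<Longrightarrow> v \<in> A \<and> mt v \<in> Nb v \<and> ow (mt v) = v \<and> mt v \<noteq> x"
    using aug unfolding augmenting_def by blast+
  \<comment> \<open>The old mate still names \<open>u\<close> as its owner; this stale entry is
    overwritten in the next step. If there is no old mate, the exempted value is \<open>0\<close>,
    for which \<open>ow 0 = 0\<close> is kept separately.\<close>
  have a1: "(\<forall>z. z \<noteq> mt u \<longrightarrow> (ow(x := u)) z \<noteq> 0 \<longrightarrow> (mt(u := x)) ((ow(x := u)) z) = z)"
    using ow_mt by (metis fun_upd_apply)
  have a2: "(\<forall>v. (mt(u := x)) v \<noteq> 0 \<longrightarrow>
      v \<in> A \<and> (mt(u := x)) v \<in> Nb v \<and> (ow(x := u)) ((mt(u := x)) v) = v \<and> (mt(u := x)) v \<noteq> mt u)"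
    using mt_ow x uA i(3) by (metis fun_upd_apply)
  have dom: "{v. (mt(u := x)) v \<noteq> 0} = insert u {v. mt0 v \<noteq> 0}"
    using aug x unfolding augmenting_def by auto
  have dist: "distinct q" using tree by (simp add: tree_def)
  show thesis
  proof (cases "i = 0")
    case True
    then have "u = c" using i tree by (simp add: tree_def)
    then have "mt u = 0" using mt0 tree by (simp add: tree_def)
    moreover have "augmenting c mt0 pa q 0 0 (ow(x := u)) (mt(u := x))"
      using a1 a2 dom aug x \<open>u = c\<close> \<open>mt u = 0\<close> unfolding augmenting_def by auto
    ultimately show thesis using that(1) by blast
  next
    case False
    then obtain j where j: "mt u \<noteq> 0" "j < i" "pa (mt u) = q ! j" "mt u \<in> Nb (q ! j)"
      using tree i mt0 unfolding tree_def by auto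
    have "q ! l \<noteq> u" if "l \<le> j" for l
      using that j i dist by (auto simp: nth_eq_iff_index_eq)
    then have "\<forall>l\<le>j. (mt(u := x)) (q ! l) = mt0 (q ! l)"
      using same j by auto
    moreover have "insert u {v. mt0 v \<noteq> 0} = {v. mt0 v \<noteq> 0}"
      using j mt0 by auto
    ultimately have "augmenting c mt0 pa q (mt u) j (ow(x := u)) (mt(u := x))"
      using a1 a2 dom aug x j i unfolding augmenting_def by auto
    then show thesis using that(2) j by blast
  qed
qed

end


section \<open>The program\<close>

text \<open>
  A clause is represented by the address of its length cell. The price limit in \<open>rCap\<close> is the square
  root of the number of clauses, rounded up. The branches that only clear \<open>rTest\<close> do nothing or
  end the enclosing loop. A bid for an unowned variable resets the mate of \<open>0\<close>, which is \<open>0\<close> anyway.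
\<close>

abbreviation (input) rAns :: nat where "rAns \<equiv> 0"
abbreviation (input) rOne :: nat where "rOne \<equiv> 1"
abbreviation (input) rEnd :: nat where "rEnd \<equiv> 2"
abbreviation (input) rCap :: nat where "rCap \<equiv> 3"
abbreviation (input) rOw :: nat where "rOw \<equiv> 4"
abbreviation (input) rPr :: nat where "rPr \<equiv> 5"
abbreviation (input) rMt :: nat where "rMt \<equiv> 6"
abbreviation (input) rSt :: nat where "rSt \<equiv> 7"
abbreviation (input) rPa :: nat where "rPa \<equiv> 8"
abbreviation (input) rQu :: nat where "rQu \<equiv> 9"
abbreviation (input) rRoot :: nat where "rRoot \<equiv> 10"
abbreviation (input) rU :: nat where "rU \<equiv> 11"
abbreviation (input) rPos :: nat where "rPos \<equiv> 12"
abbreviation (input) rX :: nat where "rX \<equiv> 13"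
abbreviation (input) rBest :: nat where "rBest \<equiv> 14"
abbreviation (input) rMin :: nat where "rMin \<equiv> 15"
abbreviation (input) rAddr :: nat where "rAddr \<equiv> 16"
abbreviation (input) rVal :: nat where "rVal \<equiv> 17"
abbreviation (input) rHead :: nat where "rHead \<equiv> 18"
abbreviation (input) rTail :: nat where "rTail \<equiv> 19"
abbreviation (input) rTest :: nat where "rTest \<equiv> 20"
abbreviation (input) rAux :: nat where "rAux \<equiv> 21"
abbreviation (input) rZero :: nat where "rZero \<equiv> 22"

text \<open>Cells are read from the last one of the clause down to its length cell, so the distance
  to the clause address is the loop counter.\<close>

definition scan_body :: com where
  "scan_body =
     Do (Load rX rPos) ;; Do (Add rAddr rPr rX) ;; Do (Load rVal rAddr) ;;
     Do (Sub rTest rMin rVal) ;;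
     Cond rTest
       (Do (Add rMin rVal rZero) ;; Do (Add rBest rX rZero))
       (Do (Const rTest 0)) ;;
     Do (Sub rPos rPos rOne) ;; Do (Sub rTest rPos rU)"

text \<open>Because \<open>rMin\<close> starts at the price limit and comparisons are strict,
  \<open>rBest\<close> stays \<open>0\<close> precisely when the clause has to give up.\<close>

definition scan :: com where
  "scan =
     Do (Const rBest 0) ;; Do (Add rMin rCap rZero) ;;
     Do (Load rPos rU) ;; Do (Add rPos rPos rU) ;; Do (Sub rTest rPos rU) ;;
     Loop rTest scan_body"

definition bid :: com where
  "bid =
     scan ;;
     Cond rBest
       (Do (Add rAddr rPr rBest) ;; Do (Add rMin rMin rOne) ;; Do (Store rAddr rMin) ;;
        Do (Add rAddr rOw rBest) ;; Do (Load rVal rAddr) ;; Do (Store rAddr rU) ;;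
        Do (Add rAddr rMt rU) ;; Do (Store rAddr rBest) ;;
        Do (Add rAddr rMt rVal) ;; Do (Store rAddr rZero) ;; Do (Add rU rVal rZero))
       (Do (Const rU 0))"

definition next_root :: com where
  "next_root =
     Do (Load rAddr rRoot) ;; Do (Add rRoot rRoot rAddr) ;; Do (Add rRoot rRoot rOne) ;;
     Do (Sub rTest rEnd rRoot)"

definition auction :: com where
  "auction =
     Do (Const rRoot 2) ;; Do (Sub rTest rEnd rRoot) ;;
     Loop rTest (Do (Add rU rRoot rZero) ;; Loop rU bid ;; next_root)"


text \<open>The sum of the two truncated differences is zero exactly if stamp and root agree, which
  replaces an equality test.\<close>

definition visit_body :: com where
  "visit_body =
     Do (Load rX rPos) ;; Do (Add rAddr rSt rX) ;; Do (Load rVal rAddr) ;;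
     Do (Sub rTest rVal rRoot) ;; Do (Sub rAux rRoot rVal) ;; Do (Add rTest rTest rAux) ;;
     Cond rTest
       (Do (Store rAddr rRoot) ;; Do (Add rAddr rPa rX) ;; Do (Store rAddr rU) ;;
        Do (Add rAddr rOw rX) ;; Do (Load rVal rAddr) ;;
        Cond rVal
          (Do (Store rTail rVal) ;; Do (Add rTail rTail rOne))
          (Do (Add rBest rX rZero)))
       (Do (Const rTest 0)) ;;
     Do (Sub rPos rPos rOne) ;; Do (Sub rTest rPos rU)"

definition explore_body :: com where
  "explore_body =
     Do (Load rU rHead) ;; Do (Add rHead rHead rOne) ;;
     Do (Load rPos rU) ;; Do (Add rPos rPos rU) ;; Do (Sub rTest rPos rU) ;;
     Loop rTest visit_body ;;
     Do (Sub rTest rTail rHead)"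

definition explore :: com where
  "explore =
     Do (Const rBest 0) ;; Do (Store rQu rRoot) ;;
     Do (Add rHead rQu rZero) ;; Do (Add rTail rQu rOne) ;; Do (Sub rTest rTail rHead) ;;
     Loop rTest explore_body"

definition augment_body :: com where
  "augment_body =
     Do (Add rAddr rPa rBest) ;; Do (Load rU rAddr) ;;
     Do (Add rAddr rMt rU) ;; Do (Load rVal rAddr) ;; Do (Store rAddr rBest) ;;
     Do (Add rAddr rOw rBest) ;; Do (Store rAddr rU) ;; Do (Add rBest rVal rZero)"

definition complete_body :: com where
  "complete_body =
     Do (Add rAddr rMt rRoot) ;; Do (Load rVal rAddr) ;;
     Cond rVal
       (Do (Const rTest 0))
       (explore ;; Cond rBest (Loop rBest augment_body) (Do (Const rAns 0))) ;;
     Cond rAns next_root (Do (Const rTest 0))"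

definition complete :: com where
  "complete =
     Do (Const rAns 1) ;; Do (Const rRoot 2) ;; Do (Sub rTest rEnd rRoot) ;;
     Loop rTest complete_body"

text \<open>Squares without multiplication: \<open>rAddr\<close> holds the square of
  \<open>rCap\<close> and grows by twice \<open>rCap\<close> plus one.\<close>

definition square_body :: com where
  "square_body =
     Do (Add rAddr rAddr rCap) ;; Do (Add rAddr rAddr rCap) ;; Do (Add rAddr rAddr rOne) ;;
     Do (Add rCap rCap rOne) ;; Do (Sub rTest rVal rAddr)"

definition skip_body :: com where
  "skip_body =
     Do (Load rAddr rEnd) ;; Do (Add rEnd rEnd rAddr) ;; Do (Add rEnd rEnd rOne) ;;
     Do (Sub rVal rVal rOne)"

text \<open>Cell \<open>0\<close> holds \<open>n\<close>, which enters the computation only through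
  these additions to addresses.\<close>

definition setup_arrays :: com where
  "setup_arrays =
     Do (Load rAddr rZero) ;; Do (Add rAddr rAddr rEnd) ;; Do (Add rOw rEnd rZero) ;;
     Do (Add rPr rOw rAddr) ;; Do (Add rMt rPr rAddr) ;; Do (Add rSt rMt rAddr) ;;
     Do (Add rPa rSt rAddr) ;; Do (Add rQu rPa rAddr)"

definition prepare :: com where
  "prepare =
     Do (Const rOne 1) ;; Do (Load rVal rOne) ;; Do (Sub rTest rVal rAddr) ;;
     Loop rTest square_body ;;
     Do (Const rEnd 2) ;; Loop rVal skip_body ;; setup_arrays"

definition decide :: com where
  "decide = prepare ;; auction ;; complete"


section \<open>Correctness and running time\<close>

text \<open>The address of the length cell of a clause, behind two header cells. Because of that
  cell addresses increase strictly even past empty clauses, so they are usable as names and as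
  stamps.\<close>

primrec adr :: "store \<Rightarrow> nat \<Rightarrow> nat" where
  "adr inp 0 = 2"
| "adr inp (Suc i) = adr inp i + inp (adr inp i) + 1"

lemma adr_mono: "i \<le> j \<Longrightarrow> adr inp i \<le> adr inp j"
  by (rule lift_Suc_mono_le[of "adr inp"]) simp_all

lemma adr_less: "i < j \<Longrightarrow> adr inp i < adr inp j"
  by (rule lift_Suc_mono_less[of "adr inp"]) simp_all

lemma adr_inject [simp]: "adr inp i = adr inp j \<longleftrightarrow> i = j"
  by (metis adr_less linorder_neq_iff)

lemma adr_ge_2: "2 \<le> adr inp i"
  using adr_mono[of 0 i inp] by simp

locale input =
  fixes inp :: store and n m s :: nat
  assumes inp_0: "inp 0 = n" and inp_1: "inp 1 = m"
    and clause_length: "i < m \<Longrightarrow> inp (adr inp i) \<le> s"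
    and variable_range:
      "i < m \<Longrightarrow> adr inp i < j \<Longrightarrow> j \<le> adr inp i + inp (adr inp i) \<Longrightarrow> 1 \<le> inp j \<and> inp j \<le> n"
    and inp_beyond: "adr inp m \<le> a \<Longrightarrow> inp a = 0"
begin

definition L :: nat where "L = adr inp m"
definition A :: "nat set" where "A = adr inp ` {..<m}"
definition Nb :: "nat \<Rightarrow> nat set" where "Nb u = inp ` {u<..u + inp u}"

sublocale clause_graph A Nb
proof
  show "finite A" by (simp add: A_def)
  have "adr inp i \<noteq> 0" for i using adr_ge_2[of inp i] by linarith
  then show "0 \<notin> A" unfolding A_def by (metis imageE)
  show "finite (Nb u)" for u by (simp add: Nb_def)
  show "0 \<notin> Nb u" if "u \<in> A" for u
    using that variable_range by (fastforce simp: A_def Nb_def)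
qed

lemma card_A: "card A = m"
  by (simp add: A_def card_image inj_on_def)

lemma L_ge_2: "2 \<le> L"
  by (simp add: L_def adr_ge_2)

lemma clauseD:
  assumes "u \<in> A"
  shows "inp u \<le> s" and "u + inp u < L"
    and "u < j \<Longrightarrow> j \<le> u + inp u \<Longrightarrow> 1 \<le> inp j \<and> inp j \<le> n"
proof -
  obtain i where i: "i < m" "u = adr inp i" using assms by (auto simp: A_def)
  then show "inp u \<le> s" "u < j \<Longrightarrow> j \<le> u + inp u \<Longrightarrow> 1 \<le> inp j \<and> inp j \<le> n"
    using clause_length variable_range by auto
  show "u + inp u < L"
    using adr_mono[of "Suc i" m inp] i by (simp add: L_def)
qed

lemma NbD: "u \<in> A \<Longrightarrow> x \<in> Nb u \<Longrightarrow> 1 \<le> x \<and> x \<le> n"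
  using clauseD(3) by (auto simp: Nb_def)

section \<open>Arrays behind the input\<close>

text \<open>
  Behind the input lie the arrays of the program: owners and prices of variables, mates of clauses,
  stamps and parents of variables, and the queue. All but the last have room for \<open>W\<close> entries.
\<close>

definition W :: nat where "W = n + L"

definition bOw :: nat where "bOw = L"
definition bPr :: nat where "bPr = L + W"
definition bMt :: nat where "bMt = L + 2 * W"
definition bSt :: nat where "bSt = L + 3 * W"
definition bPa :: nat where "bPa = L + 4 * W"
definition bQu :: nat where "bQu = L + 5 * W"

text \<open>With the memory written as a function of six abstract arrays, loads and stores become
  rewriting. The queue lies last and is unbounded, so access to it needs no range condition.\<close>

definition mem :: "store \<Rightarrow> store \<Rightarrow> store \<Rightarrow> store \<Rightarrow> store \<Rightarrow> store \<Rightarrow> store" where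
  "mem ow pr mt st pa qu a =
     (if a < bOw then inp a
      else if a < bPr then ow (a - bOw)
      else if a < bMt then pr (a - bPr)
      else if a < bSt then mt (a - bMt)
      else if a < bPa then st (a - bSt)
      else if a < bQu then pa (a - bPa)
      else qu (a - bQu))"

lemmas base_defs = bOw_def bPr_def bMt_def bSt_def bPa_def bQu_def

lemma mem_input [simp]: "a < L \<Longrightarrow> mem ow pr mt st pa qu a = inp a"
  by (simp add: mem_def base_defs)

lemma mem_read [simp]:
  "x < W \<Longrightarrow> mem ow pr mt st pa qu (bOw + x) = ow x"
  "x < W \<Longrightarrow> mem ow pr mt st pa qu (bPr + x) = pr x"
  "x < W \<Longrightarrow> mem ow pr mt st pa qu (bMt + x) = mt x"
  "x < W \<Longrightarrow> mem ow pr mt st pa qu (bSt + x) = st x"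
  "x < W \<Longrightarrow> mem ow pr mt st pa qu (bPa + x) = pa x"
  "mem ow pr mt st pa qu (bQu + x) = qu x"
  by (simp_all add: mem_def base_defs)

lemma mem_write [simp]:
  "x < W \<Longrightarrow> (mem ow pr mt st pa qu)(bOw + x := v) = mem (ow(x := v)) pr mt st pa qu"
  "x < W \<Longrightarrow> (mem ow pr mt st pa qu)(bPr + x := v) = mem ow (pr(x := v)) mt st pa qu"
  "x < W \<Longrightarrow> (mem ow pr mt st pa qu)(bMt + x := v) = mem ow pr (mt(x := v)) st pa qu"
  "x < W \<Longrightarrow> (mem ow pr mt st pa qu)(bSt + x := v) = mem ow pr mt (st(x := v)) pa qu"
  "x < W \<Longrightarrow> (mem ow pr mt st pa qu)(bPa + x := v) = mem ow pr mt st (pa(x := v)) qu"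
  "(mem ow pr mt st pa qu)(bQu + x := v) = mem ow pr mt st pa (qu(x := v))"
  by (rule ext; auto simp: mem_def base_defs)+

text \<open>Blank memory reads as no owners, price zero, no mates and no stamps, the state in which
  the auction starts.\<close>

lemma mem_zero: "mem (\<lambda>_. 0) (\<lambda>_. 0) (\<lambda>_. 0) (\<lambda>_. 0) (\<lambda>_. 0) (\<lambda>_. 0) = inp"
  using inp_beyond by (auto simp: mem_def base_defs L_def)

text \<open>\<open>W\<close> exceeds all variables and all clause addresses, so arrays indexed by
  either can share one size.\<close>

lemma variable_less_W: "x \<le> n \<Longrightarrow> x < W"
  using L_ge_2 by (simp add: W_def)

lemma clause_less_W: "u \<in> A \<Longrightarrow> u < W"
  using clauseD(2)[of u] by (simp add: W_def)

lemma W_pos: "0 < W"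
  using L_ge_2 by (simp add: W_def)

definition ready :: "nat \<Rightarrow> store \<Rightarrow> bool" where
  "ready k R \<longleftrightarrow>
     R rOne = 1 \<and> R rEnd = L \<and> R rCap = k \<and> R rZero = 0 \<and> R rOw = bOw \<and> R rPr = bPr \<and>
     R rMt = bMt \<and> R rSt = bSt \<and> R rPa = bPa \<and> R rQu = bQu"


subsection \<open>The auction\<close>

text \<open>\<open>b = 0\<close> encodes that nothing is affordable: the first conjunct then says
  that every variable costs at least \<open>k\<close>.\<close>

definition cheapest :: "nat \<Rightarrow> store \<Rightarrow> nat set \<Rightarrow> nat \<Rightarrow> nat \<Rightarrow> bool" where
  "cheapest k pr X b p \<longleftrightarrow>
     (\<forall>x \<in> X. p \<le> pr x) \<and> (if b = 0 then p = k else b \<in> X \<and> p = pr b \<and> p < k)"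

lemma cheapest_insert:
  assumes "cheapest k pr X b p" and "x \<noteq> 0"
  shows "cheapest k pr (insert x X) (if pr x < p then x else b) (if pr x < p then pr x else p)"
  using assms unfolding cheapest_def by (fastforce split: if_splits)

lemma wp_scan:
  assumes u: "u \<in> A" "R rU = u" and ready: "ready k R"
    and post: "\<And>T' R'. ready k R' \<Longrightarrow> R' rU = u \<Longrightarrow> R' rRoot = R rRoot \<Longrightarrow>
      cheapest k pr (Nb u) (R' rBest) (R' rMin) \<Longrightarrow> T' \<le> T + 12 * s + 6 \<Longrightarrow>
      Q T' R' (mem ow pr mt st pa qu)"
  shows "wp scan Q T R (mem ow pr mt st pa qu)"
proof -
  define M where "M = mem ow pr mt st pa qu"
  \<comment> \<open>The cells beyond \<open>rPos\<close> have been scanned. Each remaining one costs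
    at most \<open>12\<close> steps: ten for the body and two for the jumps of the loop.\<close>
  define I where "I T' R' M' \<longleftrightarrow> M' = M \<and> ready k R' \<and> R' rU = u \<and> R' rRoot = R rRoot \<and>
    R' rTest = R' rPos - u \<and> u \<le> R' rPos \<and> R' rPos \<le> u + inp u \<and>
    cheapest k pr (inp ` {R' rPos<..u + inp u}) (R' rBest) (R' rMin) \<and>
    T' + 12 * (R' rPos - u) \<le> T + 12 * s + 5" for T' R' M'
  have M: "M u = inp u" using clauseD(2)[OF u(1)] by (simp add: M_def)
  have loop: "wp (Loop rTest scan_body) Q T' R' M'" if "I T' R' M'" for T' R' M'
    using that
  proof (rule wp_Loop[where I = I and B = "T + 12 * s + 5"])
    fix T' R' M' assume I: "I T' R' M'" and "R' rTest = 0"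
    then have "R' rPos = u" by (simp add: I_def)
    then show "Q (T' + 1) R' M'"
      using I post[of R' "T' + 1"] by (simp add: I_def M_def Nb_def)
  next
    fix T' R' M' assume I: "I T' R' M'" and "R' rTest \<noteq> 0"
    define p where "p = R' rPos"
    have p: "u < p" "p \<le> u + inp u" using I \<open>R' rTest \<noteq> 0\<close> by (auto simp: I_def p_def)
    have x: "1 \<le> inp p" "inp p \<le> n" using clauseD(3)[OF u(1) p] by auto
    have rd: "M p = inp p" "M (bPr + inp p) = pr (inp p)"
      using p clauseD(2)[OF u(1)] variable_less_W[OF x(2)] by (auto simp: M_def)
    have "{p - 1<..u + inp u} = insert p {p<..u + inp u}" using p by auto
    then have "cheapest k pr (inp ` {p - 1<..u + inp u})
        (if pr (inp p) < R' rMin then inp p else R' rBest)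
        (if pr (inp p) < R' rMin then pr (inp p) else R' rMin)"
      using cheapest_insert[of k pr "inp ` {p<..u + inp u}" "R' rBest" "R' rMin" "inp p"] I x
      by (simp add: I_def p_def)
    then show "wp scan_body I (T' + 2) R' M'"
      using I p rd unfolding scan_body_def
      by (auto simp: I_def p_def[symmetric] ready_def split: if_splits)
  qed (simp add: I_def)
  show ?thesis
    unfolding scan_def M_def[symmetric]
    using u ready M clauseD(1)[OF u(1)]
    by (simp, intro loop) (simp add: I_def ready_def cheapest_def)
qed

text \<open>A potential: every bid raises a price, unless the clause gives up, which ends the bidding.\<close>

definition progress :: "nat \<Rightarrow> store \<Rightarrow> nat" where
  "progress u pr = sum pr {1..n} + (if u = 0 then 1 else 0)"

lemma wp_bid:
  assumes bidding: "bidding k S u ow mt pr" and u: "u \<noteq> 0" "R rU = u" and ready: "ready k R"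
    and post: "\<And>T' R' ow' mt' pr'. ready k R' \<Longrightarrow> R' rRoot = R rRoot \<Longrightarrow>
      bidding k S (R' rU) ow' mt' pr' \<Longrightarrow> progress u pr + 1 \<le> progress (R' rU) pr' \<Longrightarrow>
      T' \<le> T + 12 * s + 19 \<Longrightarrow> Q T' R' (mem ow' pr' mt' st pa qu)"
  shows "wp bid Q T R (mem ow pr mt st pa qu)"
  unfolding bid_def wp_Seq
proof (rule wp_scan)
  have uA: "u \<in> A" using bidding u(1) unfolding bidding_def by blast
  show "u \<in> A" by fact
  fix T' R'
  assume R': "ready k R'" "R' rU = u" "R' rRoot = R rRoot" and T': "T' \<le> T + 12 * s + 6"
    and cheap: "cheapest k pr (Nb u) (R' rBest) (R' rMin)"
  define x where "x = R' rBest"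
  let ?c = "Cond rBest
       (Do (Add rAddr rPr rBest) ;; Do (Add rMin rMin rOne) ;; Do (Store rAddr rMin) ;;
        Do (Add rAddr rOw rBest) ;; Do (Load rVal rAddr) ;; Do (Store rAddr rU) ;;
        Do (Add rAddr rMt rU) ;; Do (Store rAddr rBest) ;;
        Do (Add rAddr rMt rVal) ;; Do (Store rAddr rZero) ;; Do (Add rU rVal rZero))
       (Do (Const rU 0))"
  show "wp ?c Q T' R' (mem ow pr mt st pa qu)"
  proof (cases "x = 0")
    case True
    have "bidding k S 0 ow mt pr"
      by (rule bidding_giveup[OF bidding]) (use cheap True in \<open>auto simp: cheapest_def x_def\<close>)
    then have "Q (T' + 2) (R'(rU := 0)) (mem ow pr mt st pa qu)"
      by (intro post) (use R' T' u in \<open>auto simp: ready_def progress_def\<close>)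
    then show ?thesis using True by (simp add: x_def)
  next
    case False
    then have x: "x \<in> Nb u" "R' rMin = pr x" "pr x < k" "\<And>y. y \<in> Nb u \<Longrightarrow> pr x \<le> pr y"
      using cheap by (auto simp: cheapest_def x_def)
    have range: "1 \<le> x" "x \<le> n" using NbD[OF uA x(1)] by auto
    note bid = bidding_bid[OF bidding u(1) x(1,3,4)]
    have less: "x < W" "u < W" using variable_less_W range clause_less_W uA by auto
    have less': "ow x < W"
    proof (cases "ow x = 0")
      case False
      then have "ow x \<in> A" using bid unfolding bidding_def by blast
      then show ?thesis by (rule clause_less_W)
    qed (simp add: W_pos)
    have "sum (pr(x := pr x + 1)) {1..n} = sum pr {1..n} + 1"
    proof -
      have "pr(x := pr x + 1) = (\<lambda>y. pr y + (if y = x then 1 else 0))" by auto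
      then show ?thesis using range by (simp add: sum.distrib)
    qed
    then have "progress u pr + 1 \<le> progress (ow x) (pr(x := pr x + 1))"
      using u(1) by (simp add: progress_def)
    then have "Q t r (mem (ow(x := u)) (pr(x := pr x + 1)) ((mt(u := x))(ow x := 0)) st pa qu)"
      if "ready k r" "r rRoot = R rRoot" "r rU = ow x" "t \<le> T + 12 * s + 19" for t r
      by (intro post) (use that bid in simp_all)
    then show ?thesis
      using False R' T' x(2) less less' by (simp add: x_def[symmetric] ready_def)
  qed
qed (use u ready in auto)

text \<open>At most \<open>12 * s + 19\<close> steps for a bid and two for the jumps of the loop
  around it.\<close>

definition bid_time :: nat where "bid_time = 12 * s + 21"

text \<open>Time is charged to the growth of the potential, since one clause may set off a long
  chain of evictions and only the total over the auction is small.\<close>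

lemma wp_bids:
  assumes "bidding k S (R rU) ow mt pr" and "ready k R"
    and post: "\<And>T' R' ow' mt' pr'. ready k R' \<Longrightarrow> R' rRoot = R rRoot \<Longrightarrow>
      bidding k S 0 ow' mt' pr' \<Longrightarrow>
      T' + bid_time * progress (R rU) pr \<le> T + bid_time * progress 0 pr' + 1 \<Longrightarrow>
      Q T' R' (mem ow' pr' mt' st pa qu)"
  shows "wp (Loop rU bid) Q T R (mem ow pr mt st pa qu)"
proof -
  define I where "I T' R' M' \<longleftrightarrow> (\<exists>ow' mt' pr'. M' = mem ow' pr' mt' st pa qu \<and>
    ready k R' \<and> R' rRoot = R rRoot \<and> bidding k S (R' rU) ow' mt' pr' \<and>
    T' + bid_time * progress (R rU) pr \<le> T + bid_time * progress (R' rU) pr')" for T' R' M'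
  show ?thesis
  proof (rule wp_Loop[where I = I and B = "T + bid_time * (k * m + 1)"])
    show "I T R (mem ow pr mt st pa qu)"
      unfolding I_def using assms(1,2) by (intro exI[of _ ow] exI[of _ mt] exI[of _ pr]) simp
  next
    fix T' R' M' assume "I T' R' M'"
    then obtain ow' mt' pr' where I: "bidding k S (R' rU) ow' mt' pr'"
      "T' + bid_time * progress (R rU) pr \<le> T + bid_time * progress (R' rU) pr'"
      unfolding I_def by blast
    have "sum pr' {1..n} \<le> k * m"
      using priced_sum_le[of k ow' mt' pr' "{1..n}"] I(1) by (simp add: bidding_def card_A)
    then have "bid_time * progress (R' rU) pr' \<le> bid_time * (k * m + 1)"
      by (intro mult_le_mono2) (simp add: progress_def)
    then show "T' \<le> T + bid_time * (k * m + 1)" using I(2) by linarith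
  next
    fix T' R' M' assume "I T' R' M'" and u: "R' rU \<noteq> 0"
    then obtain ow' mt' pr' where I: "M' = mem ow' pr' mt' st pa qu" "ready k R'"
      "R' rRoot = R rRoot" "bidding k S (R' rU) ow' mt' pr'"
      "T' + bid_time * progress (R rU) pr \<le> T + bid_time * progress (R' rU) pr'"
      unfolding I_def by blast
    show "wp bid I (T' + 2) R' M'"
      unfolding I(1)
    proof (rule wp_bid[OF I(4) u refl I(2)])
      fix T'' R'' ow'' mt'' pr''
      assume new: "ready k R''" "R'' rRoot = R' rRoot" "bidding k S (R'' rU) ow'' mt'' pr''"
        and more: "progress (R' rU) pr' + 1 \<le> progress (R'' rU) pr''"
        and T'': "T'' \<le> T' + 2 + 12 * s + 19"
      have T'_le: "T'' \<le> T' + bid_time" using T'' by (simp add: bid_time_def)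
      have "bid_time * (progress (R' rU) pr' + 1) \<le> bid_time * progress (R'' rU) pr''"
        using more by (rule mult_le_mono2)
      then have "T'' + bid_time * progress (R rU) pr \<le> T + bid_time * progress (R'' rU) pr''"
        using I(5) T'' T'_le unfolding distrib_left by linarith
      then show "I T'' R'' (mem ow'' pr'' mt'' st pa qu)"
        unfolding I_def using new I(3)
        by (intro exI[of _ ow''] exI[of _ mt''] exI[of _ pr'']) simp
    qed
  next
    fix T' R' M' assume "I T' R' M'" and "R' rU = 0"
    then show "Q (T' + 1) R' M'"
      unfolding I_def by (auto intro!: post)
  qed
qed

lemma clause_set_Suc: "adr inp ` {..<Suc i} = insert (adr inp i) (adr inp ` {..<i})"
  by (simp add: lessThan_Suc)

lemma adr_in_A: "i < m \<Longrightarrow> adr inp i \<in> A"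
  by (simp add: A_def)

lemma wp_next_root:
  assumes "i < m" and "R rRoot = adr inp i" and "ready k R"
    and post: "\<And>T' R'. T' = T + 4 \<Longrightarrow> ready k R' \<Longrightarrow> R' rRoot = adr inp (Suc i) \<Longrightarrow> R' rTest = L - adr inp (Suc i) \<Longrightarrow>
      R' rAns = R rAns \<Longrightarrow> Q T' R' (mem ow pr mt st pa qu)"
  shows "wp next_root Q T R (mem ow pr mt st pa qu)"
proof -
  have "adr inp i < L" using clauseD(2)[OF adr_in_A[OF assms(1)]] by simp
  then show ?thesis
    unfolding next_root_def using assms(2,3)
    by (simp add: ready_def) (intro post; simp add: ready_def)
qed

lemma wp_auction:
  assumes "ready k R"
    and post: "\<And>T' R' ow mt pr. ready k R' \<Longrightarrow> bidding k A 0 ow mt pr \<Longrightarrow>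
      T' \<le> T + bid_time * (k * m) + (bid_time + 8) * m + 3 \<Longrightarrow>
      Q T' R' (mem ow pr mt (\<lambda>_. 0) (\<lambda>_. 0) (\<lambda>_. 0))"
  shows "wp auction Q T R inp"
proof -
  define M where "M ow mt pr = mem ow pr mt (\<lambda>_. 0) (\<lambda>_. 0) (\<lambda>_. 0)" for ow mt pr
  define body where "body = Do (Add rU rRoot rZero) ;; Loop rU bid ;; next_root"
  \<comment> \<open>Beyond the price increases, each clause is charged one \<open>bid_time\<close>,
    from the potential gained when its bidding ends, and \<open>8\<close> steps: two loop jumps, one
    copy, one loop exit and four for \<open>next_root\<close>.\<close>
  define I where "I T' R' M' \<longleftrightarrow> (\<exists>i ow mt pr. M' = M ow mt pr \<and> i \<le> m \<and>
    ready k R' \<and> R' rRoot = adr inp i \<and> R' rTest = L - adr inp i \<and>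
    bidding k (adr inp ` {..<i}) 0 ow mt pr \<and>
    T' \<le> T + bid_time * sum pr {1..n} + (bid_time + 8) * i + 2)" for T' R' M'
  have bound: "bid_time * sum pr {1..n} \<le> bid_time * (k * m)"
    if "bidding k S u ow mt pr" for S u ow mt pr
    using priced_sum_le[of k ow mt pr "{1..n}"] that
    by (intro mult_le_mono2) (simp add: bidding_def card_A)
  have "wp (Loop rTest body) Q T' R' M'" if "I T' R' M'" for T' R' M'
    using that
  proof (rule wp_Loop[where I = I and B = "T + bid_time * (k * m) + (bid_time + 8) * m + 2"])
    fix T' R' M' assume "I T' R' M'"
    then obtain i ow mt pr where I: "i \<le> m" "bidding k (adr inp ` {..<i}) 0 ow mt pr"
      "T' \<le> T + bid_time * sum pr {1..n} + (bid_time + 8) * i + 2"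
      unfolding I_def by blast
    have "(bid_time + 8) * i \<le> (bid_time + 8) * m" using I(1) by (rule mult_le_mono2)
    then show "T' \<le> T + bid_time * (k * m) + (bid_time + 8) * m + 2"
      using I(3) bound[OF I(2)] by linarith
  next
    fix T' R' M' assume "I T' R' M'" and "R' rTest \<noteq> 0"
    then obtain i ow mt pr where I: "M' = M ow mt pr" "i \<le> m" "ready k R'"
      "R' rRoot = adr inp i" "R' rTest = L - adr inp i"
      "bidding k (adr inp ` {..<i}) 0 ow mt pr"
      "T' \<le> T + bid_time * sum pr {1..n} + (bid_time + 8) * i + 2"
      unfolding I_def by blast
    have i: "i < m" using I(2,5) \<open>R' rTest \<noteq> 0\<close> by (cases "i = m") (auto simp: L_def)
    define R1 where "R1 = R'(rU := adr inp i)"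
    have R1: "ready k R1" "R1 rU = adr inp i" "R1 rRoot = adr inp i"
      using I(3,4) by (auto simp: R1_def ready_def)
    have u: "adr inp i \<noteq> 0" using adr_ge_2[of inp i] by linarith
    have enter: "bidding k (adr inp ` {..<Suc i}) (R1 rU) ow mt pr"
      unfolding clause_set_Suc R1(2)
      by (rule bidding_enter[OF I(6) adr_in_A[OF i]]) auto
    have "wp (Loop rU bid) (wp next_root I) (Suc (Suc (Suc T'))) R1 (M ow mt pr)"
      unfolding M_def
    proof (rule wp_bids[OF enter R1(1)])
      fix T'' R'' ow' mt' pr'
      assume R'': "ready k R''" "R'' rRoot = R1 rRoot"
        and bidding: "bidding k (adr inp ` {..<Suc i}) 0 ow' mt' pr'"
        and T'': "T'' + bid_time * progress (R1 rU) pr \<le>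
          Suc (Suc (Suc T')) + bid_time * progress 0 pr' + 1"
      have time: "T'' + 4 \<le> T + bid_time * sum pr' {1..n} + (bid_time + 8) * Suc i + 2"
        using T'' I(7) u unfolding R1(2) progress_def by (simp add: algebra_simps)
      show "wp next_root I T'' R'' (mem ow' pr' mt' (\<lambda>_. 0) (\<lambda>_. 0) (\<lambda>_. 0))"
      proof (intro wp_next_root[OF i _ R''(1)])
        show "R'' rRoot = adr inp i" using R''(2) R1(3) by simp
        fix t r
        assume "t = T'' + 4" "ready k r" "r rRoot = adr inp (Suc i)" "r rTest = L - adr inp (Suc i)"
        then show "I t r (mem ow' pr' mt' (\<lambda>_. 0) (\<lambda>_. 0) (\<lambda>_. 0))"
          unfolding I_def M_def using time bidding i
          by (intro exI[of _ "Suc i"] exI[of _ ow'] exI[of _ mt'] exI[of _ pr']) simp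
      qed
    qed
    then show "wp body I (T' + 2) R' M'"
      using I(1,3,4) by (simp add: body_def R1_def ready_def)
  next
    fix T' R' M' assume "I T' R' M'" and "R' rTest = 0"
    then obtain i ow mt pr where I: "M' = M ow mt pr" "i \<le> m" "ready k R'"
      "R' rTest = L - adr inp i" "bidding k (adr inp ` {..<i}) 0 ow mt pr"
      "T' \<le> T + bid_time * sum pr {1..n} + (bid_time + 8) * i + 2"
      unfolding I_def by blast
    have "i = m"
      using I(2,4) \<open>R' rTest = 0\<close> adr_less[of i m inp] by (cases "i = m") (auto simp: L_def)
    then have bidding: "bidding k A 0 ow mt pr" using I(5) by (simp only: A_def)
    have "T' + 1 \<le> T + bid_time * (k * m) + (bid_time + 8) * m + 3"
      using I(6) bound[OF bidding] unfolding \<open>i = m\<close> by linarith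
    then show "Q (T' + 1) R' M'"
      using post[OF I(3) bidding] I(1) by (simp add: M_def)
  qed
  moreover have "I (T + 2) (R(rRoot := 2, rTest := L - 2)) (M (\<lambda>_. 0) (\<lambda>_. 0) (\<lambda>_. 0))"
    unfolding I_def using assms(1) bidding_init
    by (intro exI[of _ 0] exI[of _ "\<lambda>_. 0"]) (simp add: ready_def)
  ultimately show ?thesis
    using assms(1) by (simp add: auction_def body_def M_def mem_zero ready_def)
qed


subsection \<open>The search\<close>

text \<open>\<open>qu\<close> is constrained only up to the length of \<open>q\<close>, as leftovers
  of earlier searches may lie behind. Stamps bounded by \<open>c\<close> are smaller than the
  address of any later root, hence fresh there.\<close>

definition searching ::
    "nat \<Rightarrow> nat \<Rightarrow> store \<Rightarrow> store \<Rightarrow> store \<Rightarrow> store \<Rightarrow> store \<Rightarrow> nat list \<Rightarrow> nat \<Rightarrow> store \<Rightarrow> bool" where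
  "searching k c ow mt st pa qu q h R \<longleftrightarrow>
     search c ow mt st pa q (R rBest) \<and> (\<forall>i<length q. qu i = q ! i) \<and> (\<forall>x. st x \<le> c) \<and>
     ready k R \<and> R rAns = 1 \<and> R rRoot = c \<and> R rHead = bQu + h \<and> R rTail = bQu + length q"

lemma searchingD:
  assumes "searching k c ow mt st pa qu q h R"
  shows "search c ow mt st pa q (R rBest)" and "i < length q \<Longrightarrow> qu i = q ! i" and "st x \<le> c"
    and "ready k R" and "R rAns = 1" and "R rRoot = c" and "R rHead = bQu + h"
    and "R rTail = bQu + length q"
  using assms unfolding searching_def by blast+

text \<open>\<open>st0\<close> and \<open>q0\<close> are the stamps and the queue from before this
  clause. That they are only extended keeps clauses finished earlier finished.\<close>

definition visiting ::
    "nat \<Rightarrow> store \<Rightarrow> nat list \<Rightarrow> nat \<Rightarrow> nat \<Rightarrow> store \<Rightarrow> nat list \<Rightarrow> store \<Rightarrow> bool" where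
  "visiting c st0 q0 u p st q R \<longleftrightarrow>
     R rU = u \<and> R rPos = p \<and> R rTest = p - u \<and> u \<le> p \<and> p \<le> u + inp u \<and>
     (\<exists>r. q = q0 @ r) \<and> (\<forall>x. st0 x = c \<longrightarrow> st x = c) \<and>
     (\<forall>j. p < j \<longrightarrow> j \<le> u + inp u \<longrightarrow> st (inp j) = c)"

lemma visiting_step:
  assumes v: "visiting c st0 q0 u p st q R" and "u < p"
    and R': "R' rU = u" "R' rPos = p - 1" "R' rTest = p - 1 - u"
    and st': "\<And>x. st x = c \<Longrightarrow> st' x = c" "st' (inp p) = c" and q': "q' = q @ r"
  shows "visiting c st0 q0 u (p - 1) st' q' R'"
proof -
  have "st' (inp j) = c" if "p - 1 < j" "j \<le> u + inp u" for j
  proof (cases "j = p")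
    case False
    then have "p < j" using that(1) by linarith
    then show ?thesis using v that(2) st'(1) unfolding visiting_def by blast
  qed (use st'(2) in simp)
  moreover have "\<exists>r. q' = q0 @ r" using v q' unfolding visiting_def by force
  moreover have "\<forall>x. st0 x = c \<longrightarrow> st' x = c" using v st'(1) unfolding visiting_def by blast
  moreover have "p - 1 \<le> u + inp u" "u \<le> p - 1"
    using v \<open>u < p\<close> unfolding visiting_def by linarith+
  ultimately show ?thesis using R' unfolding visiting_def by blast
qed

lemma wp_visit_body:
  assumes S: "searching k c ow mt st pa qu q h R" and u: "u \<in> set q"
    and v: "visiting c st0 q0 u p st q R" and p: "u < p"
    and post: "\<And>T' R' st' pa' qu' q'. searching k c ow mt st' pa' qu' q' h R' \<Longrightarrow>
      visiting c st0 q0 u (p - 1) st' q' R' \<Longrightarrow> T' \<le> T + 19 \<Longrightarrow>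
      Q T' R' (mem ow pr mt st' pa' qu')"
  shows "wp visit_body Q T R (mem ow pr mt st pa qu)"
proof -
  have uA: "u \<in> A" using searchD(2)[OF searchingD(1)[OF S]] u unfolding tree_def by blast
  have reg: "R rU = u" "R rPos = p" "R rTest = p - u" "p \<le> u + inp u"
    using v unfolding visiting_def by blast+
  define x where "x = inp p"
  have "p < L" using reg(4) clauseD(2)[OF uA] by simp
  have x: "x \<noteq> 0" "x < W" "x \<in> Nb u"
    using clauseD(3)[OF uA p reg(4)] variable_less_W p reg(4) by (auto simp: x_def Nb_def)
  have ready: "R rOne = 1" "R rEnd = L" "R rCap = k" "R rZero = 0" "R rOw = bOw" "R rPr = bPr"
     "R rMt = bMt" "R rSt = bSt" "R rPa = bPa" "R rQu = bQu"
    using searchingD(4)[OF S] by (simp_all add: ready_def)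
  note simps = ready[simplified] reg searchingD(5-8)[OF S] x(2) \<open>p < L\<close> x_def[symmetric]
  show ?thesis
  proof (cases "st x = c")
    case True
    have "Q t r (mem ow pr mt st pa qu)"
      if "\<And>j. j \<notin> {rPos, rTest, rAddr, rVal, rX, rAux} \<Longrightarrow> r j = R j" "r rPos = p - 1"
        "r rTest = p - 1 - u" "t \<le> T + 19" for t r
    proof (rule post)
      show "searching k c ow mt st pa qu q h r"
        using S that(1) by (simp add: searching_def ready_def)
      show "visiting c st0 q0 u (p - 1) st q r"
        by (rule visiting_step[OF v p, where r = "[]"]) (use that True simps in auto)
    qed (use that in simp)
    then show ?thesis
      using True by (simp add: visit_body_def simps)
  next
    case False
    then have ne: "st x < c" using searchingD(3)[OF S, of x] by linarith
    have stamp: "(st(x := c)) y \<le> c" for y using searchingD(3)[OF S] by simp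
    show ?thesis
    proof (cases "ow x = 0")
      case unowned: True
      have new: "search c ow mt (st(x := c)) (pa(x := u)) q x"
        by (rule search_unowned[OF searchingD(1)[OF S] u x(3) False unowned])
      have "Q t r (mem ow pr mt (st(x := c)) (pa(x := u)) qu)"
        if "\<And>j. j \<notin> {rPos, rTest, rAddr, rVal, rX, rAux, rBest} \<Longrightarrow> r j = R j" "r rPos = p - 1"
          "r rTest = p - 1 - u" "r rBest = x" "t \<le> T + 19" for t r
      proof (rule post)
        show "searching k c ow mt (st(x := c)) (pa(x := u)) qu q h r"
          unfolding searching_def ready_def that(4)
          using new stamp searchingD(2)[OF S] that(1) by (simp add: simps)
        show "visiting c st0 q0 u (p - 1) (st(x := c)) q r"
          by (rule visiting_step[OF v p, where r = "[]"]) (use that simps in auto)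
      qed (use that in simp)
      then show ?thesis
        using ne unowned by (simp add: visit_body_def simps)
    next
      case owned: False
      have new: "search c ow mt (st(x := c)) (pa(x := u)) (q @ [ow x]) (R rBest)"
        by (rule search_owned[OF searchingD(1)[OF S] u x(3) False owned])
      have "Q t r (mem ow pr mt (st(x := c)) (pa(x := u)) (qu(length q := ow x)))"
        if "\<And>j. j \<notin> {rPos, rTest, rAddr, rVal, rX, rAux, rTail} \<Longrightarrow> r j = R j" "r rPos = p - 1"
          "r rTest = p - 1 - u" "r rTail = bQu + length q + 1" "t \<le> T + 19" for t r
      proof (rule post)
        have "(qu(length q := ow x)) i = (q @ [ow x]) ! i" if "i < length (q @ [ow x])" for i
          using that searchingD(2)[OF S, of i] by (simp add: nth_append)
        then show "searching k c ow mt (st(x := c)) (pa(x := u)) (qu(length q := ow x)) (q @ [ow x]) h r"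
          unfolding searching_def ready_def
          using new stamp that(1,4) by (simp add: simps)
        show "visiting c st0 q0 u (p - 1) (st(x := c)) (q @ [ow x]) r"
          by (rule visiting_step[OF v p, where r = "[ow x]"]) (use that simps in auto)
      qed (use that in simp)
      then show ?thesis
        using ne owned by (simp add: visit_body_def simps)
    qed
  qed
qed

lemma wp_visit:
  assumes S: "searching k c ow mt st pa qu q h R" and u: "u \<in> set q" "R rU = u"
    and pos: "R rPos = u + inp u" "R rTest = inp u"
    and post: "\<And>T' R' st' pa' qu' q' r. searching k c ow mt st' pa' qu' (q @ r) h R' \<Longrightarrow>
      (\<And>x. st x = c \<Longrightarrow> st' x = c) \<Longrightarrow> (\<And>x. x \<in> Nb u \<Longrightarrow> st' x = c) \<Longrightarrow>
      T' \<le> T + 21 * s + 1 \<Longrightarrow> Q T' R' (mem ow pr mt st' pa' qu')"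
  shows "wp (Loop rTest visit_body) Q T R (mem ow pr mt st pa qu)"
proof -
  have uA: "u \<in> A" using searchD(2)[OF searchingD(1)[OF S]] u unfolding tree_def by blast
  \<comment> \<open>The factor \<open>21\<close> is at most \<open>19\<close> steps for the body
    plus two loop jumps.\<close>
  define I where "I T' R' M' \<longleftrightarrow> (\<exists>st' pa' qu' q' p. M' = mem ow pr mt st' pa' qu' \<and>
    searching k c ow mt st' pa' qu' q' h R' \<and> visiting c st q u p st' q' R' \<and>
    T' + 21 * (p - u) \<le> T + 21 * s)" for T' R' M'
  show ?thesis
  proof (rule wp_Loop[where I = I and B = "T + 21 * s"])
    have "visiting c st q u (u + inp u) st q R"
      unfolding visiting_def using u pos by auto
    then show "I T R (mem ow pr mt st pa qu)"
      unfolding I_def using S clauseD(1)[OF uA]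
      by (intro exI[of _ st] exI[of _ pa] exI[of _ qu] exI[of _ q] exI[of _ "u + inp u"]) simp
  next
    fix T' R' M' assume "I T' R' M'"
    then show "T' \<le> T + 21 * s" unfolding I_def by auto
  next
    fix T' R' M' assume "I T' R' M'" and test: "R' rTest = 0"
    then obtain st' pa' qu' q' p where I: "M' = mem ow pr mt st' pa' qu'"
      "searching k c ow mt st' pa' qu' q' h R'" "visiting c st q u p st' q' R'"
      "T' + 21 * (p - u) \<le> T + 21 * s"
      unfolding I_def by blast
    obtain r where r: "q' = q @ r" using I(3) unfolding visiting_def by blast
    have "p = u" using I(3) test unfolding visiting_def by auto
    have "st' x = c" if "x \<in> Nb u" for x
      using that I(3) unfolding visiting_def \<open>p = u\<close> Nb_def by auto
    moreover have "st' x = c" if "st x = c" for x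
      using that I(3) unfolding visiting_def by blast
    ultimately show "Q (T' + 1) R' M'"
      unfolding I(1) using I(2,4) unfolding r by (intro post) simp_all
  next
    fix T' R' M' assume "I T' R' M'" and test: "R' rTest \<noteq> 0"
    then obtain st' pa' qu' q' p where I: "M' = mem ow pr mt st' pa' qu'"
      "searching k c ow mt st' pa' qu' q' h R'" "visiting c st q u p st' q' R'"
      "T' + 21 * (p - u) \<le> T + 21 * s"
      unfolding I_def by blast
    have "R' rTest = p - u" using I(3) unfolding visiting_def by blast
    then have p: "u < p" using test by simp
    have "u \<in> set q'" using u(1) I(3) unfolding visiting_def by auto
    then show "wp visit_body I (T' + 2) R' M'"
      unfolding I(1)
    proof (rule wp_visit_body[OF I(2) _ I(3) p])
      fix T'' R'' st'' pa'' qu'' q''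
      assume "searching k c ow mt st'' pa'' qu'' q'' h R''" "visiting c st q u (p - 1) st'' q'' R''"
        and "T'' \<le> T' + 2 + 19"
      moreover have "p - u = (p - 1 - u) + 1" using p by simp
      then have "T'' + 21 * (p - 1 - u) \<le> T + 21 * s"
        using I(4) \<open>T'' \<le> T' + 2 + 19\<close> by linarith
      ultimately show "I T'' R'' (mem ow pr mt st'' pa'' qu'')"
        unfolding I_def by blast
    qed
  qed
qed

text \<open>Each clause is queued at most once; hence a search takes time
  \<open>O(m s)\<close>.\<close>

lemma search_length_le:
  assumes "search c ow mt st pa q f"
  shows "length q \<le> m"
proof -
  have "distinct q" "set q \<subseteq> A" using searchD(2)[OF assms] unfolding tree_def by blast+
  then show ?thesis using card_mono[OF finite_A] card_A by (metis distinct_card)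
qed

lemma wp_explore:
  assumes ready: "ready k R" and R: "R rAns = 1" "R rRoot = c"
    and c: "matching ow mt" "c \<in> A" "mt c = 0" "\<And>x. st x < c"
    and post: "\<And>T' R' st' pa' qu' q. ready k R' \<Longrightarrow> R' rAns = 1 \<Longrightarrow> R' rRoot = c \<Longrightarrow>
      search c ow mt st' pa' q (R' rBest) \<Longrightarrow> (\<And>x. st' x \<le> c) \<Longrightarrow>
      (\<And>u x. u \<in> set q \<Longrightarrow> x \<in> Nb u \<Longrightarrow> st' x = c) \<Longrightarrow>
      T' \<le> T + (21 * s + 9) * m + 6 \<Longrightarrow> Q T' R' (mem ow pr mt st' pa' qu')"
  shows "wp explore Q T R (mem ow pr mt st pa qu)"
proof -
  \<comment> \<open>Queue entries before \<open>h\<close> are exhausted. Each costs at most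
    \<open>21 * s + 1\<close> for its variables, six further instructions and two loop
    jumps.\<close>
  define I where "I T' R' M' \<longleftrightarrow> (\<exists>st' pa' qu' q h. M' = mem ow pr mt st' pa' qu' \<and>
    searching k c ow mt st' pa' qu' q h R' \<and> h \<le> length q \<and> R' rTest = length q - h \<and>
    (\<forall>i<h. \<forall>x \<in> Nb (q ! i). st' x = c) \<and> T' \<le> T + 5 + (21 * s + 9) * h)" for T' R' M'
  have loop: "wp (Loop rTest explore_body) Q T' R' M'" if "I T' R' M'" for T' R' M'
    using that
  proof (rule wp_Loop[where I = I and B = "T + 5 + (21 * s + 9) * m"])
    fix T' R' M' assume "I T' R' M'"
    then obtain st' pa' qu' q h where I: "searching k c ow mt st' pa' qu' q h R'" "h \<le> length q"
      "T' \<le> T + 5 + (21 * s + 9) * h"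
      unfolding I_def by blast
    have "h \<le> m" using I(2) search_length_le[OF searchingD(1)[OF I(1)]] by simp
    then have "(21 * s + 9) * h \<le> (21 * s + 9) * m" by (rule mult_le_mono2)
    then show "T' \<le> T + 5 + (21 * s + 9) * m" using I(3) by linarith
  next
    fix T' R' M' assume "I T' R' M'" and test: "R' rTest = 0"
    then obtain st' pa' qu' q h where I: "M' = mem ow pr mt st' pa' qu'"
      "searching k c ow mt st' pa' qu' q h R'" "h \<le> length q" "R' rTest = length q - h"
      "\<And>i x. i < h \<Longrightarrow> x \<in> Nb (q ! i) \<Longrightarrow> st' x = c" "T' \<le> T + 5 + (21 * s + 9) * h"
      unfolding I_def by blast
    have h: "h = length q" using I(3,4) test by simp
    have "(21 * s + 9) * h \<le> (21 * s + 9) * m"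
      unfolding h by (rule mult_le_mono2[OF search_length_le[OF searchingD(1)[OF I(2)]]])
    then have "T' + 1 \<le> T + (21 * s + 9) * m + 6" using I(6) by linarith
    moreover have "st' x = c" if "u \<in> set q" "x \<in> Nb u" for u x
      using that I(5) h by (metis in_set_conv_nth)
    ultimately show "Q (T' + 1) R' M'"
      unfolding I(1) using searchingD(1,3,4,5,6)[OF I(2)] by (intro post[of R']) auto
  next
    fix T' R' M' assume "I T' R' M'" and test: "R' rTest \<noteq> 0"
    then obtain st' pa' qu' q h where I: "M' = mem ow pr mt st' pa' qu'"
      "searching k c ow mt st' pa' qu' q h R'" "R' rTest = length q - h"
      "\<And>i x. i < h \<Longrightarrow> x \<in> Nb (q ! i) \<Longrightarrow> st' x = c" "T' \<le> T + 5 + (21 * s + 9) * h"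
      unfolding I_def by blast
    have h: "h < length q" using I(3) test by simp
    define u where "u = q ! h"
    have u: "u \<in> set q" "qu' h = u" using h searchingD(2)[OF I(2) h] by (auto simp: u_def)
    have "u \<in> A" using searchD(2)[OF searchingD(1)[OF I(2)]] u(1) unfolding tree_def by blast
    then have "u < L" using clauseD(2) by fastforce
    have ready': "R' rOne = 1" using searchingD(4)[OF I(2)] by (simp add: ready_def)
    define R1 where "R1 = R'(rU := u, rHead := bQu + (h + 1), rPos := inp u + u, rTest := inp u)"
    have S1: "searching k c ow mt st' pa' qu' q (h + 1) R1"
      using I(2) unfolding searching_def ready_def R1_def by simp
    have "wp (Loop rTest visit_body) (wp (Do (Sub rTest rTail rHead)) I)
        (Suc (Suc (Suc (Suc (Suc (T' + 2)))))) R1 M'"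
      unfolding I(1)
    proof (rule wp_visit[OF S1 u(1)])
      fix T'' R'' st'' pa'' qu'' r
      assume new: "searching k c ow mt st'' pa'' qu'' (q @ r) (h + 1) R''"
        "\<And>x. st' x = c \<Longrightarrow> st'' x = c" "\<And>x. x \<in> Nb u \<Longrightarrow> st'' x = c"
        "T'' \<le> Suc (Suc (Suc (Suc (Suc (T' + 2))))) + 21 * s + 1"
      have "I (T'' + 1) (R''(rTest := length (q @ r) - (h + 1))) (mem ow pr mt st'' pa'' qu'')"
        unfolding I_def
      proof (intro exI conjI)
        show "searching k c ow mt st'' pa'' qu'' (q @ r) (h + 1)
            (R''(rTest := length (q @ r) - (h + 1)))"
          using new(1) by (simp add: searching_def ready_def)
        show "\<forall>i<h + 1. \<forall>x \<in> Nb ((q @ r) ! i). st'' x = c"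
        proof (intro allI impI ballI)
          fix i x assume i: "i < h + 1" and x: "x \<in> Nb ((q @ r) ! i)"
          have "x \<in> Nb (q ! i)" using i x h by (simp add: nth_append)
          then show "st'' x = c"
            using new(2,3) I(4)[of i x] i by (cases "i = h") (auto simp: u_def)
        qed
        show "T'' + 1 \<le> T + 5 + (21 * s + 9) * (h + 1)"
          using new(4) I(5) by (simp add: algebra_simps)
      qed (use h in simp_all)
      then show "wp (Do (Sub rTest rTail rHead)) I T'' R'' (mem ow pr mt st'' pa'' qu'')"
        using searchingD(7,8)[OF new(1)] by simp
    qed (simp_all add: R1_def)
    then show "wp explore_body I (T' + 2) R' M'"
      using I(1) u(2) searchingD(7)[OF I(2)] ready' \<open>u < L\<close>
      by (simp add: explore_body_def R1_def)
  qed
  have "I (Suc (Suc (Suc (Suc (Suc T))))) (R(rBest := 0, rHead := bQu, rTail := bQu + 1, rTest := 1))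
      (mem ow pr mt st pa (qu(0 := c)))"
    unfolding I_def
  proof (intro exI conjI)
    show "searching k c ow mt st pa (qu(0 := c)) [c] 0
        (R(rBest := 0, rHead := bQu, rTail := bQu + 1, rTest := 1))"
      using search_init[OF c(1-3), of st] c(4) ready R
      by (simp add: searching_def ready_def less_imp_le less_imp_neq)
  qed simp_all
  note loop[OF this]
  moreover have "(mem ow pr mt st pa qu)(bQu := c) = mem ow pr mt st pa (qu(0 := c))"
    using mem_write(6)[of ow pr mt st pa qu 0 c] by simp
  ultimately show ?thesis
    using ready R unfolding explore_def by (simp add: ready_def)
qed

lemma wp_augment:
  assumes S: "search c ow mt st pa q (R rBest)" and "R rBest \<noteq> 0" and ready: "ready k R"
    and post: "\<And>T' R' ow' mt'. ready k R' \<Longrightarrow> R' rAns = R rAns \<Longrightarrow> R' rRoot = R rRoot \<Longrightarrow>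
      matching ow' mt' \<Longrightarrow> {u. mt' u \<noteq> 0} = insert c {u. mt u \<noteq> 0} \<Longrightarrow>
      T' \<le> T + 10 * m + 1 \<Longrightarrow> Q T' R' (mem ow' pr mt' st pa qu)"
  shows "wp (Loop rBest augment_body) Q T R (mem ow pr mt st pa qu)"
proof -
  have tree: "tree c mt pa q" by (rule searchD(2)[OF S])
  \<comment> \<open>Eight instructions and two loop jumps per step. The remaining time is measured
    by the queue position, which avoids speaking of the length of the path.\<close>
  define I where "I T' R' M' \<longleftrightarrow> (\<exists>ow' mt' i. M' = mem ow' pr mt' st pa qu \<and>
    augmenting c mt pa q (R' rBest) i ow' mt' \<and> ready k R' \<and> R' rAns = R rAns \<and> R' rRoot = R rRoot \<and>
    T' + (if R' rBest = 0 then 0 else 10 * (i + 1)) \<le> T + 10 * m)" for T' R' M'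
  show ?thesis
  proof (rule wp_Loop[where I = I and B = "T + 10 * m"])
    obtain i where "i < length q" "augmenting c mt pa q (R rBest) i ow mt"
      using augmenting_init[OF S \<open>R rBest \<noteq> 0\<close>] .
    then show "I T R (mem ow pr mt st pa qu)"
      unfolding I_def using ready search_length_le[OF S]
      by (intro exI[of _ ow] exI[of _ mt] exI[of _ i]) simp
  next
    fix T' R' M' assume "I T' R' M'"
    then show "T' \<le> T + 10 * m" unfolding I_def by auto
  next
    fix T' R' M' assume "I T' R' M'" and "R' rBest = 0"
    then obtain ow' mt' i where I: "M' = mem ow' pr mt' st pa qu"
      "augmenting c mt pa q 0 i ow' mt'" "ready k R'" "R' rAns = R rAns" "R' rRoot = R rRoot"
      "T' \<le> T + 10 * m"
      unfolding I_def by auto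
    show "Q (T' + 1) R' M'"
      unfolding I(1) using augmenting_final[OF I(2)] I(3-) by (intro post) simp_all
  next
    fix T' R' M' assume "I T' R' M'" and x0: "R' rBest \<noteq> 0"
    then obtain ow' mt' i where I: "M' = mem ow' pr mt' st pa qu"
      "augmenting c mt pa q (R' rBest) i ow' mt'" "ready k R'" "R' rAns = R rAns" "R' rRoot = R rRoot"
      "T' + 10 * (i + 1) \<le> T + 10 * m"
      using x0 unfolding I_def by auto
    define x where "x = R' rBest"
    define u where "u = pa x"
    have u: "u \<in> A" "x \<in> Nb u"
      using I(2) tree x0 unfolding augmenting_def tree_def u_def x_def by (metis nth_mem subsetD)+
    have less: "u < W" "x < W" using clause_less_W[OF u(1)] NbD[OF u] variable_less_W by auto
    have body: "wp augment_body I (T' + 2) R' M'"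
      if aug: "augmenting c mt pa q (mt' u) j (ow'(x := u)) (mt'(u := x))" "mt' u \<noteq> 0 \<Longrightarrow> j < i" for j
    proof -
      have "I t r (mem (ow'(x := u)) pr (mt'(u := x)) st pa qu)"
        if "\<And>j. j \<notin> {rAddr, rU, rVal, rBest} \<Longrightarrow> r j = R' j" "r rBest = mt' u" "t \<le> T' + 10" for t r
        unfolding I_def
      proof (intro exI conjI)
        show "augmenting c mt pa q (r rBest) j (ow'(x := u)) (mt'(u := x))"
          using aug(1) that(2) by simp
        show "ready k r" "r rAns = R rAns" "r rRoot = R rRoot"
          using that(1) I(3-5) by (simp_all add: ready_def)
        show "t + (if r rBest = 0 then 0 else 10 * (j + 1)) \<le> T + 10 * m"
          using aug(2) that(2,3) I(6) by auto
      qed simp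
      then show ?thesis
        using I(1,3) less by (simp add: augment_body_def ready_def x_def[symmetric] u_def[symmetric])
    qed
    show "wp augment_body I (T' + 2) R' M'"
    proof (rule augmenting_step[OF I(2) tree x0 refl, folded x_def, folded u_def])
      assume "mt' u = 0" and "augmenting c mt pa q 0 0 (ow'(x := u)) (mt'(u := x))"
      then show ?thesis by (intro body[of 0]) simp_all
    next
      fix j
      assume "mt' u \<noteq> 0" "j < i" "augmenting c mt pa q (mt' u) j (ow'(x := u)) (mt'(u := x))"
      then show ?thesis by (intro body[of j])
    qed
  qed
qed


subsection \<open>Completing the matching\<close>

text \<open>Exploration takes at most \<open>(21 * s + 9) * m + 6\<close> steps, augmentation
  \<open>10 * m + 1\<close>, and the rest of the iteration \<open>13\<close>.\<close>

definition search_time :: nat where "search_time = (21 * s + 19) * m + 20"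

lemma wp_complete:
  assumes bidding: "bidding k A 0 ow0 mt0 pr" and ready: "ready k R" and k: "m \<le> k * k"
    and post: "\<And>T' R' M'. R' rAns = of_bool (\<exists>g. saturates g A) \<Longrightarrow>
      T' \<le> T + 13 * m + search_time * (k + 1) + 4 \<Longrightarrow> Q T' R' M'"
  shows "wp complete Q T R (mem ow0 pr mt0 (\<lambda>_. 0) (\<lambda>_. 0) (\<lambda>_. 0))"
proof -
  define D where "D = {u. mt0 u \<noteq> 0}"
  define B where "B = T + 3 + 13 * m + search_time * (k + 1)"
  have priced: "priced k ow0 mt0 pr" using bidding unfolding bidding_def by blast
  \<comment> \<open>\<open>D\<close> holds the clauses matched in the auction, \<open>F\<close>
    those added by searches. Passing an already matched clause costs \<open>13\<close>
    steps.\<close>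
  define going where "going T' R' M' i ow mt st pa qu F \<longleftrightarrow>
    M' = mem ow pr mt st pa qu \<and> ready k R' \<and> R' rAns = 1 \<and>
    i \<le> m \<and> R' rRoot = adr inp i \<and> R' rTest = L - adr inp i \<and> matching ow mt \<and>
    {u. mt u \<noteq> 0} = D \<union> F \<and> F \<subseteq> A \<and> F \<inter> D = {} \<and> adr inp ` {..<i} \<subseteq> D \<union> F \<and>
    (\<forall>x. st x < adr inp i) \<and> T' \<le> T + 3 + 13 * i + search_time * card F"
    for T' R' M' i ow mt st pa qu F
  \<comment> \<open>The first disjunct is the state after a failed search, when the loop is about to
    stop.\<close>
  define I where "I T' R' M' \<longleftrightarrow>
    T' \<le> B \<and> R' rAns = 0 \<and> R' rTest = 0 \<and> (\<nexists>g. saturates g A) \<or>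
    (\<exists>i ow mt st pa qu F. going T' R' M' i ow mt st pa qu F)" for T' R' M'
  have card_F: "card F \<le> k" if "going T' R' M' i ow mt st pa qu F" for T' R' M' i ow mt st pa qu F
  proof -
    have g: "matching ow mt" "{u. mt u \<noteq> 0} = D \<union> F" "F \<subseteq> A" "F \<inter> D = {}"
      using that unfolding going_def by blast+
    \<comment> \<open>The current matching is itself the witness that all of \<open>D\<close> and
      \<open>F\<close> can be matched together, while prices and unmatched clauses are those left by
      the auction.\<close>
    have "card F * k \<le> card A"
    proof (rule priced_deficiency[OF priced g(3)])
      show "saturates mt ({u. mt0 u \<noteq> 0} \<union> F)"
        using matching_saturates[OF g(1)] g(2) unfolding D_def by simp
      show free: "mt0 u = 0" if "u \<in> F" for u
        using that g(4) unfolding D_def by blast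
      fix u y assume u: "u \<in> F" "y \<in> Nb u"
      then have "u \<in> A" using g(3) by blast
      then have "u \<noteq> 0" using zero_notin_A by metis
      then show "k \<le> pr y" using u \<open>u \<in> A\<close> free bidding unfolding bidding_def by blast
    qed
    then have "card F * k \<le> k * k" using k card_A by linarith
    moreover have "card F = 0" if "k = 0"
      using that k card_A card_mono[OF finite_A g(3)] by simp
    ultimately show ?thesis by (cases "k = 0") auto
  qed
  have bound: "T' \<le> B" if g: "going T' R' M' i ow mt st pa qu F" for T' R' M' i ow mt st pa qu F
  proof -
    have "search_time * card F \<le> search_time * (k + 1)"
      using card_F[OF g] by (intro mult_le_mono2) simp
    moreover have "T' \<le> T + 3 + 13 * i + search_time * card F" "i \<le> m"
      using g unfolding going_def by blast+
    ultimately show ?thesis unfolding B_def by linarith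
  qed
  have loop: "wp (Loop rTest complete_body) Q T' R' M'" if "I T' R' M'" for T' R' M'
    using that
  proof (rule wp_Loop[where I = I and B = B])
    fix T' R' M' assume "I T' R' M'"
    then show "T' \<le> B" unfolding I_def using bound by blast
  next
    fix T' R' M' assume I: "I T' R' M'" and test: "R' rTest = 0"
    have "R' rAns = of_bool (\<exists>g. saturates g A)"
    proof (cases "R' rAns = 0 \<and> (\<nexists>g. saturates g A)")
      case False
      then obtain i ow mt st pa qu F where g: "going T' R' M' i ow mt st pa qu F"
        using I unfolding I_def by blast
      have "L - adr inp i = 0" "i \<le> m" using g test unfolding going_def by auto
      then have "i = m" using adr_less[of i m inp] by (cases "i = m") (auto simp: L_def)
      then have "A \<subseteq> D \<union> F" using g unfolding going_def A_def by blast
      then have "saturates mt A"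
        using g matching_saturates saturates_subset unfolding going_def by metis
      moreover have "R' rAns = 1" using g unfolding going_def by blast
      ultimately show ?thesis by auto
    qed simp
    moreover have "T' \<le> B" using I unfolding I_def using bound by blast
    ultimately show "Q (T' + 1) R' M'" by (intro post) (simp_all add: B_def)
  next
    fix T' R' M' assume I: "I T' R' M'" and test: "R' rTest \<noteq> 0"
    then obtain i ow mt st pa qu F where g: "going T' R' M' i ow mt st pa qu F"
      unfolding I_def by blast
    have g': "M' = mem ow pr mt st pa qu" "ready k R'" "R' rAns = 1"
      "R' rRoot = adr inp i" "R' rTest = L - adr inp i" "matching ow mt"
      "{u. mt u \<noteq> 0} = D \<union> F" "F \<subseteq> A" "F \<inter> D = {}" "adr inp ` {..<i} \<subseteq> D \<union> F"
      "\<And>x. st x < adr inp i" "T' \<le> T + 3 + 13 * i + search_time * card F" "i \<le> m"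
      using g unfolding going_def by blast+
    have i: "i < m" using g'(5,13) test by (cases "i = m") (auto simp: L_def)
    define c where "c = adr inp i"
    have c: "c \<in> A" "c < W" using adr_in_A[OF i] clause_less_W by (auto simp: c_def)
    have c_less: "c < adr inp (Suc i)" by (simp add: c_def)
    have advance: "wp next_root I t r (mem ow' pr mt' st' pa' qu')"
      if "ready k r" "r rAns = 1" "r rRoot = c" "matching ow' mt'"
        "{u. mt' u \<noteq> 0} = D \<union> F'" "F' \<subseteq> A" "F' \<inter> D = {}" "adr inp ` {..<Suc i} \<subseteq> D \<union> F'"
        "\<And>x. st' x \<le> c" "t + 4 \<le> T + 3 + 13 * Suc i + search_time * card F'"
      for t r ow' mt' st' pa' qu' F'
    proof (rule wp_next_root[OF i _ that(1)])
      fix t' r'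
      assume r': "t' = t + 4" "ready k r'" "r' rRoot = adr inp (Suc i)" "r' rTest = L - adr inp (Suc i)"
        "r' rAns = r rAns"
      have "st' x < adr inp (Suc i)" for x using that(9) c_less by (rule le_less_trans)
      then have "going t' r' (mem ow' pr mt' st' pa' qu') (Suc i) ow' mt' st' pa' qu' F'"
        unfolding going_def using that r' i by simp
      then show "I t' r' (mem ow' pr mt' st' pa' qu')" unfolding I_def by blast
    qed (use that(3) in \<open>simp add: c_def\<close>)
    show "wp complete_body I (T' + 2) R' M'"
    proof (cases "mt c = 0")
      case False
      have "wp next_root I t r (mem ow pr mt st pa qu)"
        if "\<And>j. j \<notin> {rAddr, rVal, rTest} \<Longrightarrow> r j = R' j" "t \<le> T' + 9" for t r
      proof (rule advance)
        show "ready k r" using that(1) g'(2) by (simp add: ready_def)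
        show "adr inp ` {..<Suc i} \<subseteq> D \<union> F"
          using g'(7,10) False unfolding clause_set_Suc c_def by blast
        show "st x \<le> c" for x using g'(11)[of x] by (simp add: c_def)
      qed (use that g' in \<open>auto simp: c_def\<close>)
      then show ?thesis
        using False g'(1-4) c(2) by (simp add: complete_body_def ready_def c_def[symmetric])
    next
      case True
      define cont where "cont = wp (Cond rAns next_root (Do (Const rTest 0))) I"
      have "wp (explore ;; Cond rBest (Loop rBest augment_body) (Do (Const rAns 0))) cont
          t r (mem ow pr mt st pa qu)"
        if r: "\<And>j. j \<notin> {rAddr, rVal} \<Longrightarrow> r j = R' j" and t: "t \<le> T' + 5" for t r
        unfolding wp_Seq
      proof (rule wp_explore)
        show "ready k r" using r g'(2) by (simp add: ready_def)
        show "r rAns = 1" "r rRoot = c" using r g'(3,4) by (auto simp: c_def)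
        show "matching ow mt" "c \<in> A" "mt c = 0" by fact+
        show "st x < c" for x using g'(11) by (simp add: c_def)
        fix t' r' st' pa' qu' q
        assume r': "ready k r'" "r' rAns = 1" "r' rRoot = c" "search c ow mt st' pa' q (r' rBest)"
          and st': "\<And>x. st' x \<le> c" "\<And>u x. u \<in> set q \<Longrightarrow> x \<in> Nb u \<Longrightarrow> st' x = c"
          and t': "t' \<le> t + (21 * s + 9) * m + 6"
        show "wp (Cond rBest (Loop rBest augment_body) (Do (Const rAns 0))) cont t' r'
            (mem ow pr mt st' pa' qu')"
        proof (cases "r' rBest = 0")
          case True
          have "\<nexists>g. saturates g A"
            using search_fails[of c ow mt st' pa' q] r'(4) st'(2) True by auto
          \<comment> \<open>The failed search is the one beyond the at most \<open>k\<close>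
            successful ones, whence the factor \<open>k + 1\<close>.\<close>
          moreover have "search_time * (card F + 1) \<le> search_time * (k + 1)"
            using card_F[OF g] by (intro mult_le_mono2) simp
          then have "t' + 4 \<le> B"
            using t t' g'(12,13) unfolding B_def search_time_def by (simp add: algebra_simps)
          ultimately have "I a b (mem ow pr mt st' pa' qu')"
            if "a \<le> t' + 4" "b rAns = 0" "b rTest = 0" for a b
            using that unfolding I_def by simp
          then show ?thesis using True by (simp add: cont_def)
        next
          case False
          have "wp (Loop rBest augment_body) cont (t' + 2) r' (mem ow pr mt st' pa' qu')"
          proof (rule wp_augment[OF r'(4) False r'(1)])
            fix t'' r'' ow' mt'
            assume r'': "ready k r''" "r'' rAns = r' rAns" "r'' rRoot = r' rRoot" "matching ow' mt'"
                "{u. mt' u \<noteq> 0} = insert c {u. mt u \<noteq> 0}"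
              and t'': "t'' \<le> t' + 2 + 10 * m + 1"
            have new: "c \<notin> D \<union> F" using \<open>mt c = 0\<close> g'(7) by blast
            have "finite F" using g'(8) finite_A finite_subset by blast
            then have card: "card (insert c F) = card F + 1" using new by simp
            have "wp next_root I (t'' + 2) r'' (mem ow' pr mt' st' pa' qu')"
            proof (rule advance[OF r''(1) _ _ r''(4), where F' = "insert c F"])
              show "{u. mt' u \<noteq> 0} = D \<union> insert c F" using r''(5) g'(7) by blast
              show "insert c F \<inter> D = {}" using new g'(9) by blast
              show "adr inp ` {..<Suc i} \<subseteq> D \<union> insert c F"
                using g'(10) unfolding clause_set_Suc c_def by blast
              show "t'' + 2 + 4 \<le> T + 3 + 13 * Suc i + search_time * card (insert c F)"
                unfolding card using t t' t'' g'(12)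
                by (simp add: search_time_def algebra_simps)
            qed (use r' r'' c g'(8) st'(1) in auto)
            then show "cont t'' r'' (mem ow' pr mt' st' pa' qu')"
              using r'(2) r''(2) by (simp add: cont_def)
          qed
          then show ?thesis using False by simp
        qed
      qed
      then show ?thesis
        using True g'(1-4) c(2)
        by (simp add: complete_body_def ready_def c_def[symmetric] cont_def)
    qed
  qed
  have "going (Suc (Suc (Suc T))) (R(rAns := 1, rRoot := 2, rTest := L - 2))
      (mem ow0 pr mt0 (\<lambda>_. 0) (\<lambda>_. 0) (\<lambda>_. 0)) 0 ow0 mt0 (\<lambda>_. 0) (\<lambda>_. 0) (\<lambda>_. 0) {}"
    using ready priced unfolding going_def D_def priced_def by (simp add: ready_def)
  then have "I (Suc (Suc (Suc T))) (R(rAns := 1, rRoot := 2, rTest := L - 2))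
      (mem ow0 pr mt0 (\<lambda>_. 0) (\<lambda>_. 0) (\<lambda>_. 0))"
    unfolding I_def by blast
  note loop[OF this]
  then show ?thesis
    using ready by (simp add: complete_def ready_def)
qed


subsection \<open>The whole program\<close>

text \<open>The condition on \<open>k - 1\<close> makes \<open>k\<close> the least number whose
  square reaches \<open>m\<close>. The factors are \<open>5 + 2\<close> steps per trial square and
  \<open>4 + 2\<close> per skipped clause.\<close>

lemma wp_prepare:
  assumes post: "\<And>T' R' k. ready k R' \<Longrightarrow> m \<le> k * k \<Longrightarrow> k = 0 \<or> (k - 1) * (k - 1) < m \<Longrightarrow>
      T' \<le> 7 * k + 6 * m + 14 \<Longrightarrow> Q T' R' inp"
  shows "wp prepare Q 0 (\<lambda>_. 0) inp"
proof -
  define I where "I T' R' M' \<longleftrightarrow> (\<exists>k. M' = inp \<and> R' rOne = 1 \<and> R' rZero = 0 \<and> R' rVal = m \<and>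
    R' rCap = k \<and> R' rAddr = k * k \<and> R' rTest = m - k * k \<and> (k = 0 \<or> (k - 1) * (k - 1) < m) \<and>
    T' \<le> 3 + 7 * k)" for T' R' M'
  define J where "J t k T' R' M' \<longleftrightarrow> (\<exists>i\<le>m. M' = inp \<and> R' rOne = 1 \<and> R' rZero = 0 \<and>
    R' rVal = m - i \<and> R' rCap = k \<and> R' rEnd = adr inp i \<and> T' \<le> t + 6 * i)" for t k T' R' M'
  have skip: "wp (Loop rVal skip_body) (wp setup_arrays Q) T' R' M'"
    if J: "J t k T' R' M'" and k: "m \<le> k * k" "k = 0 \<or> (k - 1) * (k - 1) < m" and t: "t \<le> 7 * k + 5"
    for t k T' R' M'
    using J
  proof (rule wp_Loop[where I = "J t k" and B = "t + 6 * m"])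
    fix T' R' M' assume "J t k T' R' M'"
    then show "T' \<le> t + 6 * m" unfolding J_def by fastforce
  next
    fix T' R' M' assume "J t k T' R' M'" and "R' rVal = 0"
    then have J: "M' = inp" "R' rOne = 1" "R' rZero = 0" "R' rCap = k" "R' rEnd = L" "T' \<le> t + 6 * m"
      unfolding J_def L_def by (auto simp: dest: le_antisym)
    have "Q a b inp"
      if "\<And>j. j \<notin> {rAddr, rOw, rPr, rMt, rSt, rPa, rQu} \<Longrightarrow> b j = R' j" "b rOw = bOw" "b rPr = bPr"
        "b rMt = bMt" "b rSt = bSt" "b rPa = bPa" "b rQu = bQu" "a \<le> T' + 9" for a b
      using that J t k by (intro post[of k]) (simp_all add: ready_def)
    then show "wp setup_arrays Q (T' + 1) R' M'"
      using J inp_0 by (simp add: setup_arrays_def base_defs W_def)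
  next
    fix T' R' M' assume "J t k T' R' M'" and v: "R' rVal \<noteq> 0"
    then obtain i where J: "i \<le> m" "M' = inp" "R' rOne = 1" "R' rZero = 0" "R' rVal = m - i"
      "R' rCap = k" "R' rEnd = adr inp i" "T' \<le> t + 6 * i"
      unfolding J_def by blast
    have "J t k a b inp"
      if "\<And>j. j \<notin> {rAddr, rEnd, rVal} \<Longrightarrow> b j = R' j" "b rEnd = adr inp (Suc i)" "b rVal = m - i - 1"
        "a \<le> T' + 6" for a b
      unfolding J_def using that J v by (intro exI[of _ "Suc i"]) simp
    then show "wp skip_body (J t k) (T' + 2) R' M'"
      using J by (simp add: skip_body_def)
  qed
  have "wp (Loop rTest square_body) (wp (Do (Const rEnd 2) ;; Loop rVal skip_body ;; setup_arrays) Q)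
      T' R' M'" if "I T' R' M'" for T' R' M'
    using that
  \<comment> \<open>This crude bound only has to ensure termination; the sharp bound on
    \<open>k\<close> is carried by the invariant.\<close>
  proof (rule wp_Loop[where I = I and B = "3 + 7 * (m + 1)"])
    fix T' R' M' assume "I T' R' M'"
    then obtain k where k: "k = 0 \<or> (k - 1) * (k - 1) < m" "T' \<le> 3 + 7 * k"
      unfolding I_def by blast
    have "k - 1 \<le> (k - 1) * (k - 1)" by (cases "k - 1") auto
    have "k - 1 \<le> m"
      using k(1)
    proof
      assume "(k - 1) * (k - 1) < m"
      then show ?thesis using \<open>k - 1 \<le> (k - 1) * (k - 1)\<close> by (rule less_imp_le[OF le_less_trans, rotated])
    qed simp
    then show "T' \<le> 3 + 7 * (m + 1)" using k(2) by arith
  next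
    fix T' R' M' assume "I T' R' M'" and "R' rTest = 0"
    then obtain k where I: "M' = inp" "R' rOne = 1" "R' rZero = 0" "R' rVal = m" "R' rCap = k"
      "m \<le> k * k" "k = 0 \<or> (k - 1) * (k - 1) < m" "T' \<le> 3 + 7 * k"
      unfolding I_def by auto
    have "J (T' + 2) k (Suc (Suc T')) (R'(rEnd := 2)) inp"
      unfolding J_def using I by (intro exI[of _ 0]) simp
    then have "wp (Loop rVal skip_body) (wp setup_arrays Q) (Suc (Suc T')) (R'(rEnd := 2)) inp"
      using I(6-8) by (intro skip[of "T' + 2" k]) simp_all
    then show "wp (Do (Const rEnd 2) ;; Loop rVal skip_body ;; setup_arrays) Q (T' + 1) R' M'"
      using I(1) by simp
  next
    fix T' R' M' assume "I T' R' M'" and test: "R' rTest \<noteq> 0"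
    then obtain k where I: "M' = inp" "R' rOne = 1" "R' rZero = 0" "R' rVal = m" "R' rCap = k"
      "R' rAddr = k * k" "k * k < m" "T' \<le> 3 + 7 * k"
      unfolding I_def by auto
    have "I a b inp"
      if "\<And>j. j \<notin> {rAddr, rCap, rTest} \<Longrightarrow> b j = R' j" "b rCap = Suc k" "b rAddr = Suc k * Suc k"
        "b rTest = m - Suc k * Suc k" "a \<le> T' + 7" for a b
      unfolding I_def using that I by (intro exI[of _ "Suc k"]) simp
    then show "wp square_body I (T' + 2) R' M'"
      using I by (simp add: square_body_def)
  qed
  moreover have "I (Suc (Suc (Suc 0))) ((\<lambda>_. 0)(rOne := 1, rVal := m, rTest := m)) inp"
    unfolding I_def by (intro exI[of _ 0]) simp
  ultimately show ?thesis
    using inp_1 by (simp add: prepare_def)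
qed

text \<open>The bounds of the three phases added up; \<open>k\<close> is existentially quantified
  because it is computed during the run.\<close>

lemma wp_decide:
  "wp decide (\<lambda>t R M. R rAns = of_bool (\<exists>g. saturates g A) \<and>
      (\<exists>k. (k = 0 \<or> (k - 1) * (k - 1) < m) \<and>
        t \<le> 7 * k + 19 * m + 21 + bid_time * (k * m) + (bid_time + 8) * m + search_time * (k + 1)))
    0 (\<lambda>_. 0) inp"
  unfolding decide_def wp_Seq
proof (rule wp_prepare)
  fix T R k
  assume *: "ready k R" "m \<le> k * k" "k = 0 \<or> (k - 1) * (k - 1) < m" "T \<le> 7 * k + 6 * m + 14"
  show "wp auction (wp complete (\<lambda>t R M. R rAns = of_bool (\<exists>g. saturates g A) \<and>
      (\<exists>k. (k = 0 \<or> (k - 1) * (k - 1) < m) \<and>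
        t \<le> 7 * k + 19 * m + 21 + bid_time * (k * m) + (bid_time + 8) * m + search_time * (k + 1))))
    T R inp"
  proof (rule wp_auction[OF *(1)])
    fix T' R' ow mt pr
    assume "ready k R'" "bidding k A 0 ow mt pr"
      "T' \<le> T + bid_time * (k * m) + (bid_time + 8) * m + 3"
    then show "wp complete (\<lambda>t R M. R rAns = of_bool (\<exists>g. saturates g A) \<and>
      (\<exists>k. (k = 0 \<or> (k - 1) * (k - 1) < m) \<and>
        t \<le> 7 * k + 19 * m + 21 + bid_time * (k * m) + (bid_time + 8) * m + search_time * (k + 1)))
      T' R' (mem ow pr mt (\<lambda>_. 0) (\<lambda>_. 0) (\<lambda>_. 0))"
      using * by (intro wp_complete) (auto intro!: exI[of _ k])
  qed
qed

end


subsection \<open>Encoded products\<close>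

lemma listset_iff: "ys \<in> listset As \<longleftrightarrow> length ys = length As \<and> (\<forall>i<length As. ys ! i \<in> As ! i)"
proof (induction As arbitrary: ys)
  case (Cons A As)
  then show ?case
    by (cases ys) (auto simp: set_Cons_def nth_Cons less_Suc_eq_0_disj split: nat.split)
qed auto

lemma multilinear_mset: "multilinear (mset ys) \<longleftrightarrow> distinct ys"
  by (auto simp: multilinear_def distinct_count_atmost_1)

lemma has_multilinear_monomial_iff:
  "has_multilinear_monomial fs \<longleftrightarrow>
     (\<exists>ys. length ys = length fs \<and> (\<forall>i<length fs. ys ! i \<in> set (fs ! i)) \<and> distinct ys)"
  by (auto simp: has_multilinear_monomial_def expansion_monomials_def listset_iff multilinear_mset)

definition memory :: "nat list \<Rightarrow> store" where
  "memory xs a = (if a < length xs then xs ! a else 0)"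

text \<open>\<open>adr\<close> reads the lengths from memory, so addresses depend on the contents of
  all earlier clauses. The contents are therefore first located at offsets computed from the list
  alone, and the induction on addresses follows.\<close>

lemma
  assumes "i \<le> length fs"
  defines "enc \<equiv> \<lambda>fs. concat (map (\<lambda>f. length f # f) fs)"
  shows adr_encode: "adr (memory (encode n fs)) i = 2 + length (enc (take i fs))"
    and memory_clause: "i < length fs \<Longrightarrow>
      memory (encode n fs) (adr (memory (encode n fs)) i) = length (fs ! i) \<and>
      (\<forall>j<length (fs ! i). memory (encode n fs) (adr (memory (encode n fs)) i + 1 + j) = fs ! i ! j)"
proof -
  have clause: "memory (encode n fs) (2 + length (enc (take i fs))) = length (fs ! i) \<and>
      (\<forall>j<length (fs ! i). memory (encode n fs) (2 + length (enc (take i fs)) + 1 + j) = fs ! i ! j)"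
    if "i < length fs" for i
  proof -
    have "enc fs = enc (take i fs) @ (length (fs ! i) # fs ! i) @ enc (drop (Suc i) fs)"
      using arg_cong[OF id_take_nth_drop[OF that], of enc] by (simp add: enc_def)
    then have "encode n fs = (n # length fs # enc (take i fs)) @
        (length (fs ! i) # fs ! i) @ enc (drop (Suc i) fs)"
      by (simp add: encode_def enc_def)
    then show ?thesis by (simp add: memory_def nth_append)
  qed
  have adr: "adr (memory (encode n fs)) i = 2 + length (enc (take i fs))" if "i \<le> length fs" for i
    using that
  proof (induction i)
    case (Suc i)
    then have "length (enc (take (Suc i) fs)) = length (enc (take i fs)) + length (fs ! i) + 1"
      by (simp add: take_Suc_conv_app_nth enc_def)
    then show ?case using Suc clause[of i] by simp
  qed (simp add: enc_def)
  show "adr (memory (encode n fs)) i = 2 + length (enc (take i fs))"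
    by (rule adr[OF assms(1)])
  then show "i < length fs \<Longrightarrow>
      memory (encode n fs) (adr (memory (encode n fs)) i) = length (fs ! i) \<and>
      (\<forall>j<length (fs ! i). memory (encode n fs) (adr (memory (encode n fs)) i + 1 + j) = fs ! i ! j)"
    using clause by simp
qed

lemma memory_clause_set:
  fixes n :: nat and fs :: "clause list"
  assumes "i < length fs"
  defines "inp \<equiv> memory (encode n fs)"
  defines "u \<equiv> adr inp i"
  shows "inp u = length (fs ! i)" and "inp ` {u<..u + inp u} = set (fs ! i)"
proof -
  have len: "inp u = length (fs ! i)" and nth: "\<And>j. j < length (fs ! i) \<Longrightarrow> inp (u + 1 + j) = fs ! i ! j"
    using memory_clause[of i fs n] assms(1) unfolding inp_def u_def by auto
  show "inp u = length (fs ! i)" by fact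
  have "{u<..u + inp u} = (\<lambda>j. u + 1 + j) ` {..<length (fs ! i)}"
  proof (intro equalityI subsetI)
    fix a assume "a \<in> {u<..u + inp u}"
    then show "a \<in> (\<lambda>j. u + 1 + j) ` {..<length (fs ! i)}"
      by (intro image_eqI[of _ _ "a - u - 1"]) (auto simp: len)
  qed (auto simp: len)
  then have "inp ` {u<..u + inp u} = (\<lambda>j. inp (u + 1 + j)) ` {..<length (fs ! i)}"
    by (simp add: image_image)
  also have "\<dots> = (\<lambda>j. fs ! i ! j) ` {..<length (fs ! i)}"
    using nth by (intro image_cong) simp_all
  also have "\<dots> = set (fs ! i)"
    by (auto simp: set_conv_nth)
  finally show "inp ` {u<..u + inp u} = set (fs ! i)" .
qed

lemma input_encode:
  assumes "pi_sigma n m s fs"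
  shows "input (memory (encode n fs)) n m s"
proof
  let ?inp = "memory (encode n fs)"
  have fs: "length fs = m" "\<And>i. i < m \<Longrightarrow> length (fs ! i) \<le> s \<and> set (fs ! i) \<subseteq> {1..n}"
    using assms by (auto simp: pi_sigma_def)
  show "?inp 0 = n" "?inp 1 = m"
    using fs(1) by (simp_all add: memory_def encode_def)
  show "?inp (adr ?inp i) \<le> s" if "i < m" for i
    using fs that memory_clause_set(1)[of i fs n] by simp
  show "1 \<le> ?inp j \<and> ?inp j \<le> n"
    if "i < m" "adr ?inp i < j" "j \<le> adr ?inp i + ?inp (adr ?inp i)" for i j
  proof -
    have "?inp j \<in> set (fs ! i)"
      using that fs(1) memory_clause_set(2)[of i fs n] by auto
    then show ?thesis using fs(2)[OF that(1)] by auto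
  qed
  show "?inp a = 0" if "adr ?inp m \<le> a" for a
    using that adr_encode[of m fs n] fs(1) by (simp add: memory_def encode_def)
qed

text \<open>Equal clauses at different positions remain different vertices, because vertices are
  addresses; \<open>adr\<close> is the bijection between positions and vertices.\<close>

lemma (in input) saturates_iff:
  assumes "\<And>i. i < m \<Longrightarrow> Nb (adr inp i) = set (fs ! i)" and "length fs = m"
  shows "(\<exists>g. saturates g A) \<longleftrightarrow> has_multilinear_monomial fs"
proof
  assume "\<exists>g. saturates g A"
  then obtain g where g: "inj_on g A" "\<And>u. u \<in> A \<Longrightarrow> g u \<in> Nb u"
    unfolding saturates_def by blast
  have "inj_on (\<lambda>i. g (adr inp i)) {..<m}"
    using g(1) by (auto simp: inj_on_def A_def)
  then have "distinct (map (\<lambda>i. g (adr inp i)) [0..<m])"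
    by (simp add: distinct_map lessThan_atLeast0)
  moreover have "g (adr inp i) \<in> set (fs ! i)" if "i < m" for i
    using g(2)[OF adr_in_A[OF that]] assms(1)[OF that] by simp
  ultimately show "has_multilinear_monomial fs"
    unfolding has_multilinear_monomial_iff
    by (intro exI[of _ "map (\<lambda>i. g (adr inp i)) [0..<m]"]) (simp add: assms(2))
next
  assume "has_multilinear_monomial fs"
  then obtain ys where ys: "length ys = m" "\<And>i. i < m \<Longrightarrow> ys ! i \<in> set (fs ! i)" "distinct ys"
    unfolding has_multilinear_monomial_iff assms(2) by blast
  have inj: "inj (adr inp)" by (simp add: inj_def)
  have "saturates (\<lambda>u. ys ! the_inv (adr inp) u) A"
    unfolding saturates_def inj_on_def A_def
    using ys assms(1) by (auto simp: the_inv_f_f[OF inj] nth_eq_iff_index_eq)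
  then show "\<exists>g. saturates g A" by blast
qed

lemma run_answers_within:
  assumes "run c (\<lambda>_. 0, memory xs) t (R, M)" and "R 0 = of_bool b"
  shows "answers_within (compile 0 c) xs t b"
proof -
  have "(step (compile 0 c) ^^ t) (initial xs) = (code_size c, R, M)"
    using run_compile[OF assms(1), of _ "[]" 0 "[]"] by (simp add: initial_def memory_def[abs_def])
  then show ?thesis
    using assms(2) by (simp add: answers_within_def halted_def answer_def)
qed

section \<open>Numerical estimates\<close>

lemma decide_time_le:
  fixes m s k :: nat
  assumes "1 \<le> m" and "1 \<le> s"
  shows "7 * k + 19 * m + 21 + (12 * s + 21) * (k * m) + (12 * s + 21 + 8) * m +
    ((21 * s + 19) * m + 20) * (k + 1) \<le> 187 * (m * s * (k + 1))"
proof -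
  \<comment> \<open>Every summand is a multiple of something at most \<open>m * s * k\<close> or at
    most \<open>m * s\<close>. The coefficients add up to \<open>100\<close> and \<open>141\<close>
    respectively, so \<open>187\<close> leaves slack.\<close>
  have b: "1 \<le> m * s" "m \<le> m * s" using assms by simp_all
  then have "k \<le> m * s * k" "m * k \<le> m * s * k" using assms by simp_all
  moreover have "(12 * s + 21) * (k * m) = 12 * (m * s * k) + 21 * (m * k)"
    "(12 * s + 21 + 8) * m = 12 * (m * s) + 29 * m"
    "((21 * s + 19) * m + 20) * (k + 1) =
       21 * (m * s * k) + 19 * (m * k) + 20 * k + 21 * (m * s) + 19 * m + 20"
    "187 * (m * s * (k + 1)) = 187 * (m * s * k) + 187 * (m * s)"
    by (simp_all add: algebra_simps)
  ultimately show ?thesis using b by linarith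
qed

text \<open>Rounding up adds at most one, and each of the two extra units is at most
  \<open>sqrt m\<close> because \<open>m\<close> is positive.\<close>

lemma sqrt_cap:
  fixes m k :: nat
  assumes "k = 0 \<or> (k - 1) * (k - 1) < m" and "1 \<le> m"
  shows "real k + 1 \<le> 3 * sqrt (real m)"
proof -
  have "1 \<le> sqrt (real m)" using assms(2) by simp
  moreover have "real k \<le> sqrt (real m) + 1"
  proof (cases "k = 0")
    case False
    then have "(k - 1) * (k - 1) \<le> m" using assms(1) by simp
    then have "real (k - 1) * real (k - 1) \<le> real m" by (metis of_nat_le_iff of_nat_mult)
    then have "real (k - 1) \<le> sqrt (real m)"
      by (intro real_le_rsqrt) (simp only: power2_eq_square)
    then show ?thesis using False by (simp add: of_nat_diff)
  qed simp
  ultimately show ?thesis by linarith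
qed

text \<open>The time bound is restricted to positive \<open>m\<close> and \<open>s\<close> because
  its right-hand side vanishes otherwise; halting with the correct answer is asserted for every
  input.\<close>

theorem theorem2:
  "\<exists>(P :: instr list) (C :: real). \<forall>(n :: nat) (m :: nat) (s :: nat) (fs :: clause list).
     pi_sigma n m s fs \<longrightarrow>
     (\<exists>t :: nat. answers_within P (encode n fs) t (has_multilinear_monomial fs) \<and>
        (m \<ge> 1 \<and> s \<ge> 1 \<longrightarrow> real t \<le> C * (real m * real s * sqrt (real m + real n))))"
proof (intro exI[of _ "compile 0 decide"] exI[of _ "561 :: real"] allI impI)
  fix n m s :: nat and fs :: "clause list"
  assume fs: "pi_sigma n m s fs"
  define inp where "inp = memory (encode n fs)"
  interpret input inp n m s unfolding inp_def by (rule input_encode[OF fs])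
  have len: "length fs = m" using fs by (simp add: pi_sigma_def)
  have sat: "(\<exists>g. saturates g A) \<longleftrightarrow> has_multilinear_monomial fs"
    using memory_clause_set(2)[of _ fs n, folded inp_def] len
    by (intro saturates_iff) (simp_all add: Nb_def)
  define time where "time k = 7 * k + 19 * m + 21 + bid_time * (k * m) + (bid_time + 8) * m +
    search_time * (k + 1)" for k
  obtain t R M k where "run decide (\<lambda>_. 0, inp) t (R, M)" "R 0 = of_bool (has_multilinear_monomial fs)"
    and k: "k = 0 \<or> (k - 1) * (k - 1) < m" and t: "t \<le> time k"
    using wp_decide unfolding wp_def sat time_def by auto
  then have run: "answers_within (compile 0 decide) (encode n fs) t (has_multilinear_monomial fs)"
    unfolding inp_def by (intro run_answers_within)
  have "real t \<le> 561 * (real m * real s * sqrt (real m + real n))" if ms: "m \<ge> 1" "s \<ge> 1"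
  proof -
    have "t \<le> 187 * (m * s * (k + 1))"
      using t decide_time_le[OF ms, of k] by (simp add: time_def bid_time_def search_time_def)
    then have "real t \<le> real (187 * (m * s * (k + 1)))" by (simp only: of_nat_le_iff)
    also have "\<dots> = 187 * (real m * real s * (real k + 1))" by (simp add: algebra_simps)
    \<comment> \<open>The factor \<open>3\<close> turns \<open>187\<close> into \<open>561\<close>.
      The time is already bounded in terms of \<open>sqrt m\<close>; adding \<open>n\<close> under
      the root only weakens the estimate.\<close>
    also have "\<dots> \<le> 187 * (real m * real s * (3 * sqrt (real m + real n)))"
    proof (intro mult_left_mono)
      have "sqrt (real m) \<le> sqrt (real m + real n)" by simp
      then show "real k + 1 \<le> 3 * sqrt (real m + real n)" using sqrt_cap[OF k ms(1)] by linarith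
    qed simp_all
    finally show ?thesis by simp
  qed
  then show "\<exists>t. answers_within (compile 0 decide) (encode n fs) t (has_multilinear_monomial fs) \<and>
      (m \<ge> 1 \<and> s \<ge> 1 \<longrightarrow> real t \<le> 561 * (real m * real s * sqrt (real m + real n)))"
    using run by blast
qed

end
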